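(* There is $\epsilon_0>0$, independent of $\lambda$, such that if $0<\epsilon<\epsilon_0$, $\|V\|_*<\epsilon^9$, $|v_q|>\epsilon^{10}$, $|\sigma||A|^2<\epsilon^{11}$ ($A\in\mathbb C$), and $\lambda_0>k_1^2(V,\epsilon_0)$, then, with $k=\lambda_0^{1/2}$, for each choice of sign $\pm$ the curve $\lambda^\pm(t)=\lambda_0$ ($t$ in the $(\frac18k^{-1}\epsilon^{10})$-neighborhood in $K$ of $\chi_q(k,\epsilon)$) is contained in the $C(V)\epsilon^{11}\lambda_0^{-1/2}$-neighborhood of the curve $\hat\lambda^\pm(t)=\lambda_0$, where $C(V)$ is a constant depending on $V$.
   Context: Setting ($l=1$, $n=2$). $\sigma\in\mathbb R$; $Q=[0,2\pi]^2$; $K=[0,1)^2$. $V(x)=\sum_{m\in\mathbb Z^2,\,0<|m|\le R_0}v_me^{i\langle m,x\rangle}$ is a real-valued trigonometric polynomial and $q\in\mathbb Z^2\setminus\{0\}$ is fixed with $v_q\ne0$. For a $2\pi$-periodic $W$ with Fourier coefficients $w_m$, $\|W\|_*=\sum_m|w_m|$. $P_j(t)=j+t$, $p_j(t)=|P_j(t)|$, $j\in\mathbb Z^2$. $H_0(t)$ is $-\Delta$ in $L^2(Q)$ with the conditions $\partial_{x_s}^ru(\dots,x_s+2\pi,\dots)=e^{2\pi it_s}\partial_{x_s}^ru(x)$, $s=1,2$, $r=0,1$. Operators are written as matrices in the basis $e^{i\langle P_s(t),x\rangle}$, $s\in\mathbb Z^2$: $H_0(t)=\mathrm{diag}(p_s^2(t))$,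 multiplication by $W$ is $(w_{s-r})_{s,r}$. Resonant set. $S(k)$ is the circle of radius $k$ centered at $0$, $S_q(k,\epsilon)=\{x\in S(k):\big||x|^2-|x-q|^2\big|<\epsilon\}$, $\mathcal K:\mathbb R^2\to K$, $\mathcal KP_m(t)=t$. $\chi_q(k,\epsilon)$ is a subset of $\mathcal KS_q(k,\epsilon)$ such that for each $t$ in it: there is $j\in\mathbb Z^2$ with $P_j(t)\in S_q(k,\epsilon)$; $|p_j^2(t)-p_{j-q}^2(t)|<\epsilon$; $\min_{m\ne j,j-q}|p_j^2(t)-p_m^2(t)|>2\epsilon^6$. The relative measure of its complement in $\mathcal KS_q(k,\epsilon)$ is less than $c\epsilon$, $c$ independent of $k$. For $t$ near $\chi_q(k,\epsilon)$, $j$ is the index attached to a nearby point of $\chi_q(k,\epsilon)$. For $t$ in the $(\frac18k^{-1}\epsilon^{10})$-neighborhood of $\chi_q(k,\epsilon)$ and $z$ on either circle $C_1^\pm=\{z:|z-\hat\lambda^\pm(t)|=d\}$, $d=\frac13\epsilon^{10}$, one has $2|p_m^2(t)-z|\ge\epsilon^6$ for $m\ne j,j-q$ and both $|\hat\lambda^+(t)-z|,|\hat\lambda^-(t)-z|\ge\frac1{12}\epsilon^{10}$. Model operator. $\hat\lambda^\pm(t)=a\pm b$, $2a=p_j^2+p_{j-q}^2$, $2b=(4|v_q|^2+(p_j^2-p_{j-q}^2)^2)^{1/2}$, are the eigenvalues of $\begin{pmatrix}p_j^2(t)&v_q\\ v_{-q}&p_{j-q}^2(t)\end{pmatrix}$.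 In "the curve $\hat\lambda^\pm(t)=\lambda_0$" this explicit function is considered for $t\in\mathbb R^2$ with $j$ held fixed (the index $j$ of the piece of curve under consideration). $P_q$ is the diagonal projection onto coordinates $j,j-q$, $\hat H_q(t)=H_0(t)+P_qVP_q$, and $\hat E^\pm(t)$ is the rank-one spectral projection of $\hat H_q(t)$ for $\hat\lambda^\pm(t)$ (supported on coordinates $j,j-q$). Construction of $\lambda^\pm$. For periodic $W$ with $\|W\|_*<\infty$ put $Y=W-P_qVP_q$ and (whenever the series converge) $\hat E^\pm_W=\hat E^\pm+\sum_{r\ge1}\hat G^\pm_{W,r}$, $\lambda_W^\pm=\hat\lambda^\pm+\sum_{r\ge1}\hat g^\pm_{W,r}$, where $\hat G^\pm_{W,r}=\frac{(-1)^{r+1}}{2\pi i}\oint_{C_1^\pm}((\hat H_q-z)^{-1}Y)^r(\hat H_q-z)^{-1}dz$, $\hat g^\pm_{W,r}=\frac{(-1)^r}{2\pi ir}\mathrm{Tr}\oint_{C_1^\pm}((\hat H_q-z)^{-1}Y)^rdz$. For $A\in\mathbb C$ put $u_W^\pm(x)=A\sum_{s}(\hat E_W^\pm)_{sj}e^{i\langle P_s(t),x\rangle}$, $\hat{\mathcal M}^\pm W=V+\sigma|u_W^\pm|^2$, $W_0^\pm=V$, $W_m^\pm=\hat{\mathcal M}^\pm W_{m-1}^\pm$. $W^\pm$ is the $\|\cdot\|_*$-limit of $W_m^\pm$ and $\lambda^\pm(t)=\lambda^\pm_{W^\pm}(t)$; it is the eigenvalue of $H_0(t)+W^\pm$ such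 that $u^\pm=u^\pm_{W^\pm}$ solves $-\Delta u^\pm+Vu^\pm+\sigma|u^\pm|^2u^\pm=\lambda^\pm u^\pm$. *)

theory Defs
  imports "HOL-Complex_Analysis.Complex_Analysis"
begin

type_synonym plane = "real \<times> real"
type_synonym idx = "int \<times> int"
type_synonym cmat = "idx \<Rightarrow> idx \<Rightarrow> complex"

definition rvec :: "idx \<Rightarrow> plane" where
  "rvec m = (real_of_int (fst m), real_of_int (snd m))"

definition wave :: "plane \<Rightarrow> plane \<Rightarrow> complex" where
  "wave p x = cis (p \<bullet> x)"

subsection \<open>Periodic functions and the norm \<open>\<parallel>W\<parallel>\<^sub>* = \<Sum>|w\<^sub>m|\<close>\<close>

definition fourier :: "(plane \<Rightarrow> complex) \<Rightarrow> idx \<Rightarrow> complex" where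
  "fourier W m =
     integral (cbox (0, 0) (2 * pi, 2 * pi)) (\<lambda>x. W x * wave (- rvec m) x) / complex_of_real ((2 * pi)\<^sup>2)"

definition periodic2 :: "(plane \<Rightarrow> complex) \<Rightarrow> bool" where
  "periodic2 W \<longleftrightarrow> (\<forall>x m. W (x + (2 * pi) *\<^sub>R rvec m) = W x)"

text \<open>The periodic functions of finite star norm. A function with absolutely summable Fourier
  coefficients agrees almost everywhere with a continuous one, and that representative is taken.\<close>

definition star_space :: "(plane \<Rightarrow> complex) set" where
  "star_space = {W. periodic2 W \<and> continuous_on UNIV W \<and> (\<lambda>m. norm (fourier W m)) summable_on UNIV}"

definition star_norm :: "(plane \<Rightarrow> complex) \<Rightarrow> real" where
  "star_norm W = (\<Sum>\<^sub>\<infinity>m. norm (fourier W m))"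

definition star_limit :: "(nat \<Rightarrow> plane \<Rightarrow> complex) \<Rightarrow> (plane \<Rightarrow> complex) \<Rightarrow> bool" where
  "star_limit F W \<longleftrightarrow> (\<forall>n. F n \<in> star_space) \<and> W \<in> star_space \<and>
     (\<lambda>n. star_norm (\<lambda>x. F n x - W x)) \<longlonglongrightarrow> 0"

definition trig_potential :: "real \<Rightarrow> (plane \<Rightarrow> complex) \<Rightarrow> bool" where
  "trig_potential R0 V \<longleftrightarrow>
     (\<exists>v. V = (\<lambda>x. \<Sum>m\<in>{m. 0 < norm (rvec m) \<and> norm (rvec m) \<le> R0}. v m * wave (rvec m) x)) \<and>
     (\<forall>x. V x \<in> \<real>)"

subsection \<open>Infinite matrices indexed by the dual lattice\<close>

definition mat_mul :: "cmat \<Rightarrow> cmat \<Rightarrow> cmat" where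
  "mat_mul M N = (\<lambda>s r. \<Sum>\<^sub>\<infinity>u. M s u * N u r)"

definition mat_one :: cmat where
  "mat_one = (\<lambda>s r. if s = r then 1 else 0)"

primrec mat_pow :: "cmat \<Rightarrow> nat \<Rightarrow> cmat" where
  "mat_pow M 0 = mat_one"
| "mat_pow M (Suc n) = mat_mul M (mat_pow M n)"

text \<open>Only used for matrices with finitely many nonzero entries in each row and column, for which
  both products are finite sums and a two-sided inverse is unique.\<close>

definition mat_inv :: "cmat \<Rightarrow> cmat" where
  "mat_inv M = (THE R. mat_mul M R = mat_one \<and> mat_mul R M = mat_one)"

definition mult_mat :: "(plane \<Rightarrow> complex) \<Rightarrow> cmat" where
  "mult_mat W = (\<lambda>s r. fourier W (s - r))"

subsection \<open>The resonant model operator\<close>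

definition P :: "idx \<Rightarrow> plane \<Rightarrow> plane" where
  "P m t = rvec m + t"

definition psq :: "idx \<Rightarrow> plane \<Rightarrow> real" where
  "psq m t = (norm (P m t))\<^sup>2"

definition H0 :: "plane \<Rightarrow> cmat" where
  "H0 t = (\<lambda>s r. if s = r then complex_of_real (psq s t) else 0)"

definition PVP :: "(plane \<Rightarrow> complex) \<Rightarrow> idx \<Rightarrow> idx \<Rightarrow> cmat" where
  "PVP V q j = (\<lambda>s r. if s \<in> {j, j - q} \<and> r \<in> {j, j - q} then mult_mat V s r else 0)"

definition Hq :: "(plane \<Rightarrow> complex) \<Rightarrow> idx \<Rightarrow> idx \<Rightarrow> plane \<Rightarrow> cmat" where
  "Hq V q j t = (\<lambda>s r. H0 t s r + PVP V q j s r)"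

text \<open>Throughout, \<open>sg\<close> is \<open>1\<close> or \<open>-1\<close> and stands for the choice of sign.\<close>

definition lam_hat :: "(plane \<Rightarrow> complex) \<Rightarrow> idx \<Rightarrow> real \<Rightarrow> idx \<Rightarrow> plane \<Rightarrow> real" where
  "lam_hat V q sg j t =
     (psq j t + psq (j - q) t) / 2 +
     sg * (sqrt (4 * (cmod (fourier V q))\<^sup>2 + (psq j t - psq (j - q) t)\<^sup>2) / 2)"

text \<open>The orthogonal projection onto the line spanned by a unit eigenvector \<open>\<psi>\<close> supported on the
  coordinates \<open>j\<close> and \<open>j - q\<close>; it does not depend on the phase of \<open>\<psi>\<close>.\<close>

definition E_hat :: "(plane \<Rightarrow> complex) \<Rightarrow> idx \<Rightarrow> real \<Rightarrow> idx \<Rightarrow> plane \<Rightarrow> cmat" where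
  "E_hat V q sg j t = (THE E. \<exists>\<psi>.
     (\<forall>s. s \<notin> {j, j - q} \<longrightarrow> \<psi> s = 0) \<and>
     (\<Sum>s\<in>{j, j - q}. (cmod (\<psi> s))\<^sup>2) = 1 \<and>
     (\<forall>s. (\<Sum>\<^sub>\<infinity>r. Hq V q j t s r * \<psi> r) = complex_of_real (lam_hat V q sg j t) * \<psi> s) \<and>
     E = (\<lambda>s r. \<psi> s * cnj (\<psi> r)))"

definition resolvent :: "(plane \<Rightarrow> complex) \<Rightarrow> idx \<Rightarrow> idx \<Rightarrow> plane \<Rightarrow> complex \<Rightarrow> cmat" where
  "resolvent V q j t z = mat_inv (\<lambda>s r. Hq V q j t s r - z * mat_one s r)"

subsection \<open>Perturbation series\<close>

definition circ_radius :: "real \<Rightarrow> real" where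
  "circ_radius \<epsilon> = \<epsilon> ^ 10 / 3"

definition circ :: "(plane \<Rightarrow> complex) \<Rightarrow> idx \<Rightarrow> real \<Rightarrow> real \<Rightarrow> idx \<Rightarrow> plane \<Rightarrow> real \<Rightarrow> complex" where
  "circ V q \<epsilon> sg j t = circlepath (complex_of_real (lam_hat V q sg j t)) (circ_radius \<epsilon>)"

definition RY :: "(plane \<Rightarrow> complex) \<Rightarrow> idx \<Rightarrow> idx \<Rightarrow> plane \<Rightarrow> (plane \<Rightarrow> complex) \<Rightarrow> complex \<Rightarrow> cmat" where
  "RY V q j t W z =
     mat_mul (resolvent V q j t z) (\<lambda>s r. mult_mat W s r - PVP V q j s r)"

definition G_hat ::
  "(plane \<Rightarrow> complex) \<Rightarrow> idx \<Rightarrow> real \<Rightarrow> real \<Rightarrow> idx \<Rightarrow> plane \<Rightarrow> (plane \<Rightarrow> complex) \<Rightarrow> nat \<Rightarrow> cmat" where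
  "G_hat V q \<epsilon> sg j t W r = (\<lambda>s s'. (- 1) ^ (r + 1) / (2 * complex_of_real pi * \<i>) *
     contour_integral (circ V q \<epsilon> sg j t)
       (\<lambda>z. mat_mul (mat_pow (RY V q j t W z) r) (resolvent V q j t z) s s'))"

text \<open>The trace is taken after the contour integration: \<open>RY\<close> itself need not be of trace class.\<close>

definition g_hat ::
  "(plane \<Rightarrow> complex) \<Rightarrow> idx \<Rightarrow> real \<Rightarrow> real \<Rightarrow> idx \<Rightarrow> plane \<Rightarrow> (plane \<Rightarrow> complex) \<Rightarrow> nat \<Rightarrow> complex" where
  "g_hat V q \<epsilon> sg j t W r = (- 1) ^ r / (2 * complex_of_real pi * \<i> * of_nat r) *
     (\<Sum>\<^sub>\<infinity>s. contour_integral (circ V q \<epsilon> sg j t) (\<lambda>z. mat_pow (RY V q j t W z) r s s))"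

definition E_pert ::
  "(plane \<Rightarrow> complex) \<Rightarrow> idx \<Rightarrow> real \<Rightarrow> real \<Rightarrow> idx \<Rightarrow> plane \<Rightarrow> (plane \<Rightarrow> complex) \<Rightarrow> cmat" where
  "E_pert V q \<epsilon> sg j t W = (\<lambda>s s'. E_hat V q sg j t s s' + (\<Sum>n. G_hat V q \<epsilon> sg j t W (Suc n) s s'))"

definition lam_pert ::
  "(plane \<Rightarrow> complex) \<Rightarrow> idx \<Rightarrow> real \<Rightarrow> real \<Rightarrow> idx \<Rightarrow> plane \<Rightarrow> (plane \<Rightarrow> complex) \<Rightarrow> complex" where
  "lam_pert V q \<epsilon> sg j t W =
     complex_of_real (lam_hat V q sg j t) + (\<Sum>n. g_hat V q \<epsilon> sg j t W (Suc n))"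

subsection \<open>The nonlinear iteration\<close>

definition u_fun ::
  "(plane \<Rightarrow> complex) \<Rightarrow> idx \<Rightarrow> complex \<Rightarrow> real \<Rightarrow> real \<Rightarrow> idx \<Rightarrow> plane \<Rightarrow> (plane \<Rightarrow> complex) \<Rightarrow>
   plane \<Rightarrow> complex" where
  "u_fun V q A \<epsilon> sg j t W x = A * (\<Sum>\<^sub>\<infinity>s. E_pert V q \<epsilon> sg j t W s j * wave (P s t) x)"

definition M_hat ::
  "(plane \<Rightarrow> complex) \<Rightarrow> idx \<Rightarrow> real \<Rightarrow> complex \<Rightarrow> real \<Rightarrow> real \<Rightarrow> idx \<Rightarrow> plane \<Rightarrow>
   (plane \<Rightarrow> complex) \<Rightarrow> plane \<Rightarrow> complex" where
  "M_hat V q \<sigma> A \<epsilon> sg j t W =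
     (\<lambda>x. V x + complex_of_real (\<sigma> * (cmod (u_fun V q A \<epsilon> sg j t W x))\<^sup>2))"

text \<open>Two star-norm limits have the same Fourier coefficients, hence (both being continuous)
  coincide, so the choice below is unique whenever a limit exists.\<close>

definition W_limit ::
  "(plane \<Rightarrow> complex) \<Rightarrow> idx \<Rightarrow> real \<Rightarrow> complex \<Rightarrow> real \<Rightarrow> real \<Rightarrow> idx \<Rightarrow> plane \<Rightarrow> plane \<Rightarrow> complex" where
  "W_limit V q \<sigma> A \<epsilon> sg j t = (SOME W. star_limit (\<lambda>n. (M_hat V q \<sigma> A \<epsilon> sg j t ^^ n) V) W)"

definition lam ::
  "(plane \<Rightarrow> complex) \<Rightarrow> idx \<Rightarrow> real \<Rightarrow> complex \<Rightarrow> real \<Rightarrow> real \<Rightarrow> idx \<Rightarrow> plane \<Rightarrow> complex" where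
  "lam V q \<sigma> A \<epsilon> sg j t = lam_pert V q \<epsilon> sg j t (W_limit V q \<sigma> A \<epsilon> sg j t)"

subsection \<open>The resonant set\<close>

definition cell :: "plane set" where
  "cell = {0..<1} \<times> {0..<1}"

definition to_cell :: "plane \<Rightarrow> plane" where
  "to_cell x = (frac (fst x), frac (snd x))"

definition Sq :: "idx \<Rightarrow> real \<Rightarrow> real \<Rightarrow> plane set" where
  "Sq q k \<epsilon> = {x. norm x = k \<and> \<bar>(norm x)\<^sup>2 - (norm (x - rvec q))\<^sup>2\<bar> < \<epsilon>}"

definition res_index :: "idx \<Rightarrow> real \<Rightarrow> real \<Rightarrow> plane \<Rightarrow> idx \<Rightarrow> bool" where
  "res_index q k \<epsilon> t j \<longleftrightarrow>
     P j t \<in> Sq q k \<epsilon> \<and>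
     \<bar>psq j t - psq (j - q) t\<bar> < \<epsilon> \<and>
     (\<forall>m. m \<noteq> j \<and> m \<noteq> j - q \<longrightarrow> \<bar>psq j t - psq m t\<bar> > 2 * \<epsilon> ^ 6)"

text \<open>The part of the neighborhood of \<open>Xq\<close> in the cell that carries the index \<open>j\<close>; the union over all
  \<open>j\<close> is the whole neighborhood if every point of \<open>Xq\<close> has an index.\<close>

definition nbhd_piece :: "idx \<Rightarrow> real \<Rightarrow> real \<Rightarrow> plane set \<Rightarrow> idx \<Rightarrow> plane set" where
  "nbhd_piece q k \<epsilon> Xq j =
     {t \<in> cell. \<exists>t0\<in>Xq. res_index q k \<epsilon> t0 j \<and> dist t t0 < 1 / 8 * (1 / k) * \<epsilon> ^ 10}"

text \<open>The angles of the points of the arcs \<open>Sq q k \<epsilon>\<close> lying over a subset \<open>X\<close> of the cell. The map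
  \<open>to_cell\<close> is injective on the circle up to finitely many points, so \<open>k\<close> times the Lebesgue measure
  of this set is the length of \<open>X\<close> on the curve \<open>to_cell ` Sq q k \<epsilon>\<close>.\<close>

definition arc_angles :: "idx \<Rightarrow> real \<Rightarrow> real \<Rightarrow> plane set \<Rightarrow> real set" where
  "arc_angles q k \<epsilon> X =
     {\<phi> \<in> {0..<2 * pi}. (k * cos \<phi>, k * sin \<phi>) \<in> Sq q k \<epsilon> \<and> to_cell (k * cos \<phi>, k * sin \<phi>) \<in> X}"

definition arc_length :: "idx \<Rightarrow> real \<Rightarrow> real \<Rightarrow> plane set \<Rightarrow> real" where
  "arc_length q k \<epsilon> X = k * measure lebesgue (arc_angles q k \<epsilon> X)"

definition resonant_set ::
  "(plane \<Rightarrow> complex) \<Rightarrow> idx \<Rightarrow> real \<Rightarrow> real \<Rightarrow> real \<Rightarrow> plane set \<Rightarrow> bool" where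
  "resonant_set V q k \<epsilon> c Xq \<longleftrightarrow>
     Xq \<subseteq> to_cell ` Sq q k \<epsilon> \<and>
     (\<forall>t\<in>Xq. \<exists>j. res_index q k \<epsilon> t j) \<and>
     arc_angles q k \<epsilon> Xq \<in> sets lebesgue \<and>
     arc_length q k \<epsilon> (to_cell ` Sq q k \<epsilon> - Xq) < c * \<epsilon> * arc_length q k \<epsilon> (to_cell ` Sq q k \<epsilon>) \<and>
     (\<forall>j. \<forall>t\<in>nbhd_piece q k \<epsilon> Xq j. \<forall>sg\<in>{1, - 1}.
        \<forall>z\<in>sphere (complex_of_real (lam_hat V q sg j t)) (circ_radius \<epsilon>).
          (\<forall>m. m \<noteq> j \<and> m \<noteq> j - q \<longrightarrow> 2 * cmod (complex_of_real (psq m t) - z) \<ge> \<epsilon> ^ 6) \<and>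
          cmod (complex_of_real (lam_hat V q 1 j t) - z) \<ge> 1 / 12 * \<epsilon> ^ 10 \<and>
          cmod (complex_of_real (lam_hat V q (- 1) j t) - z) \<ge> 1 / 12 * \<epsilon> ^ 10)"

end

theory Submission
  imports Defs
begin

text \<open>
  Give the coordinates \<open>j\<close> and \<open>j - q\<close> the weight \<open>1\<close> and all others the weight \<open>1 / \<epsilon>\<^sup>2\<close>. On the
  contour the resolvent of the model operator is of order \<open>1 / \<epsilon>^10\<close> on the resonant block and
  \<open>1 / \<epsilon>^6\<close> off it, so a block entry of \<open>Y\<close> (of size \<open>\<epsilon>^11\<close>) and a pair of entries joining the block to
  its complement (each of size \<open>\<epsilon>^9\<close>) both contribute \<open>O(\<epsilon>)\<close> to the weighted \<open>\<ell>\<^sup>1\<close> norm of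
  resolvent times \<open>Y\<close>. Hence the series for the projection converges geometrically, the nonlinear
  iteration is a contraction in the star norm, and its limit \<open>W\<close> satisfies
  \<open>\<parallel>W - V\<parallel> \<le> 100 \<epsilon>^11\<close>. Paths that never visit the block contribute functions holomorphic in the disc,
  so only paths through the block enter the traces, whose absolutely convergent sums give
  \<open>|\<lambda> - model eigenvalue| = O(\<epsilon>^10 \<cdot> \<epsilon>)\<close>. Finally, moving \<open>t\<close> in the direction of \<open>P j t\<close> changes the
  model eigenvalue at rate at least \<open>k\<close>, so by the intermediate value theorem its level curve is
  reached within distance \<open>O(\<epsilon>^11 / k)\<close>.
\<close>

subsection \<open>Weighted column bounds for infinite matrices\<close>

text \<open>The weight answers the coupling between the block and its complement. A block row of the
  resolvent meeting an entry of size \<open>\<epsilon>^9\<close> gives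
  \<open>1 / \<epsilon>\<close>, which is not small; the way back gives only
  \<open>\<epsilon>^9 / \<epsilon>^6 = \<epsilon>^3\<close>. A weight \<open>w\<close> on the
  complement turns these two factors into \<open>1 / (\<epsilon> * w)\<close> and
  \<open>w * \<epsilon>^3\<close>, and they balance at \<open>w = 1 / \<epsilon>^2\<close>, where
  both are \<open>\<epsilon>\<close>. Inside the block no such exchange is possible. There
  \<open>Y\<close> is of order \<open>\<epsilon>^11\<close> because subtracting \<open>PVP\<close>
  removes the contribution of \<open>V\<close> and leaves that of \<open>W - V\<close>, which
  carries the coupling \<open>\<sigma> * |A|^2\<close>.

  The second obstacle is the trace over infinitely many diagonal entries of powers that need not be
  trace class. Each power is compared with the same power of the matrix whose block rows are
  deleted. The deleted matrix integrates to zero entry by entry, while the difference is dominated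
  by a rank-one majorant; this gives the summability of the trace as well as its size. The
  difference of \<open>n\<close>-th powers costs a factor \<open>n\<close>, which the
  \<open>1 / n\<close> in the trace formula absorbs.\<close>

text \<open>Bundling nonnegativity with a bound on finite partial sums yields summability together
  with a bound on \<open>infsum\<close>. A bound on \<open>infsum\<close> alone would be void for a
  non-summable family, whose \<open>infsum\<close> is \<open>0\<close>.\<close>

definition sum_le :: "('a \<Rightarrow> real) \<Rightarrow> real \<Rightarrow> bool" where
  "sum_le f c \<longleftrightarrow> (\<forall>x. 0 \<le> f x) \<and> (\<forall>S. finite S \<longrightarrow> sum f S \<le> c)"

lemma sum_leI: "(\<And>x. 0 \<le> f x) \<Longrightarrow> (\<And>S. finite S \<Longrightarrow> sum f S \<le> c) \<Longrightarrow> sum_le f c"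
  by (simp add: sum_le_def)

lemma sum_le_nonneg: "sum_le f c \<Longrightarrow> 0 \<le> f x"
  by (simp add: sum_le_def)

lemma sum_le_bound_nonneg: "sum_le f c \<Longrightarrow> 0 \<le> c"
  unfolding sum_le_def by (metis finite.emptyI sum.empty)

lemma sum_le_finite: "sum_le f c \<Longrightarrow> finite S \<Longrightarrow> sum f S \<le> c"
  by (simp add: sum_le_def)

lemma sum_le_point: "sum_le f c \<Longrightarrow> f x \<le> c"
  using sum_le_finite[of f c "{x}"] by simp

lemma sum_le_summable: "sum_le f c \<Longrightarrow> f summable_on UNIV"
  unfolding sum_le_def by (intro nonneg_bdd_above_summable_on) (auto simp: bdd_above_def)

lemma sum_le_infsum: "sum_le f c \<Longrightarrow> infsum f UNIV \<le> c"
  by (rule infsum_le_finite_sums) (auto simp: sum_le_summable sum_le_finite)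

lemma sum_le_of_summable:
  assumes "f summable_on UNIV" "\<And>x. 0 \<le> f x" "infsum f UNIV \<le> c" shows "sum_le f c"
proof (rule sum_leI[OF assms(2)])
  show "sum f S \<le> c" if "finite S" for S
    using finite_sum_le_infsum[OF assms(1) that] assms(2,3) by force
qed

lemma sum_le_mono:
  assumes "sum_le g c" "\<And>x. 0 \<le> f x" "\<And>x. f x \<le> g x" "c \<le> c'" shows "sum_le f c'"
proof (rule sum_leI[OF assms(2)])
  show "sum f S \<le> c'" if "finite S" for S
    using sum_le_finite[OF assms(1) that] sum_mono[of S f g] assms(3,4) by force
qed

lemma sum_le_add:
  assumes "sum_le f c" "sum_le g d" shows "sum_le (\<lambda>x. f x + g x) (c + d)"
  using assms unfolding sum_le_def by (auto simp: sum.distrib add_mono)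

lemma sum_le_cmult:
  assumes "sum_le f c" "0 \<le> a" shows "sum_le (\<lambda>x. a * f x) (a * c)"
  using assms unfolding sum_le_def by (auto simp: sum_distrib_left[symmetric] mult_left_mono)

lemma sum_le_abs_summable:
  fixes f :: "'a \<Rightarrow> complex"
  assumes "sum_le g c" "\<And>x. cmod (f x) \<le> g x"
  shows "f summable_on UNIV" and "cmod (infsum f UNIV) \<le> infsum g UNIV"
proof -
  have a: "(\<lambda>x. norm (f x)) summable_on UNIV"
    by (rule summable_on_comparison_test[OF sum_le_summable[OF assms(1)]]) (auto simp: assms)
  then show "f summable_on UNIV" by (rule abs_summable_summable)
  have "cmod (infsum f UNIV) \<le> infsum (\<lambda>x. norm (f x)) UNIV" by (rule norm_infsum_bound[OF a])
  also have "\<dots> \<le> infsum g UNIV"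
    by (rule infsum_mono[OF a sum_le_summable[OF assms(1)]]) (rule assms)
  finally show "cmod (infsum f UNIV) \<le> infsum g UNIV" .
qed

lemma sum_le_comp_inj:
  assumes "sum_le f c" "inj g" shows "sum_le (\<lambda>x. f (g x)) c"
proof (rule sum_leI)
  fix S :: "'b set" assume "finite S"
  have "(\<Sum>x\<in>S. f (g x)) = sum f (g ` S)"
    using assms(2) by (subst sum.reindex) (auto simp: inj_on_def)
  also have "\<dots> \<le> c" using assms(1) \<open>finite S\<close> by (simp add: sum_le_def)
  finally show "(\<Sum>x\<in>S. f (g x)) \<le> c" .
qed (use assms in \<open>simp add: sum_le_def\<close>)

lemma has_sum_finite_sum:
  fixes f :: "'i \<Rightarrow> 'a \<Rightarrow> 'b::topological_comm_monoid_add"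
  assumes "\<And>i. i \<in> S \<Longrightarrow> (f i has_sum c i) A"
  shows "((\<lambda>x. \<Sum>i\<in>S. f i x) has_sum (\<Sum>i\<in>S. c i)) A"
  using assms
proof (induction S rule: infinite_finite_induct)
  case (insert i S)
  then show ?case by (simp add: has_sum_add)
qed simp_all

lemma infsum_minus:
  fixes f g :: "'a \<Rightarrow> complex"
  assumes "f summable_on A" "g summable_on A"
  shows "infsum (\<lambda>x. f x - g x) A = infsum f A - infsum g A"
  using infsum_add[OF assms(1) summable_on_uminus[THEN iffD2, OF assms(2)]] by (simp add: infsum_uminus)

text \<open>The operator norm on weighted l1 is a supremum over columns; for nonnegative
  \<open>m\<close> this is the bound \<open>\<kappa>\<close> on its norm with respect to the weight
  \<open>om\<close>.\<close>

definition colb :: "('a \<Rightarrow> real) \<Rightarrow> ('a \<Rightarrow> 'a \<Rightarrow> real) \<Rightarrow> real \<Rightarrow> bool" where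
  "colb om m \<kappa> \<longleftrightarrow> (\<forall>r. sum_le (\<lambda>s. om s * m s r) (\<kappa> * om r))"

lemma colb_point:
  assumes "colb om m \<kappa>" "\<And>s. 1 \<le> om s" shows "0 \<le> m s r" "m s r \<le> \<kappa> * om r / om s" "0 \<le> \<kappa>"
proof -
  have o: "0 < om s" for s using assms(2)[of s] by simp
  have a: "sum_le (\<lambda>s. om s * m s r) (\<kappa> * om r)" using assms by (simp add: colb_def)
  show "0 \<le> m s r" using sum_le_nonneg[OF a, of s] o[of s] by (simp add: zero_le_mult_iff)
  show "m s r \<le> \<kappa> * om r / om s" using sum_le_point[OF a, of s] o[of s] by (simp add: field_simps)
  show "0 \<le> \<kappa>" using sum_le_bound_nonneg[OF a] o[of r] by (simp add: zero_le_mult_iff)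
qed

text \<open>By \<open>colb_point\<close> each row of \<open>m\<close> is at most a multiple of
  \<open>om\<close>, so its product with \<open>x\<close> is summable. The norm is tested on finite
  sets of rows, so exchanging the sums is just additivity of \<open>infsum\<close>.\<close>

lemma majorant_apply:
  assumes m: "colb om m \<kappa>" and om: "\<And>s. 1 \<le> om s"
      and x: "sum_le (\<lambda>u. om u * x u) c" and xn: "\<And>u. 0 \<le> x u"
  shows "(\<lambda>u. m s u * x u) summable_on UNIV"
    and "sum_le (\<lambda>s. om s * (\<Sum>\<^sub>\<infinity>u. m s u * x u)) (\<kappa> * c)"
proof -
  note mp = colb_point[OF m om]
  have o: "0 < om s" for s using om[of s] by simp
  have summ: "(\<lambda>u. m s u * x u) summable_on UNIV" for s
  proof (rule summable_on_comparison_test)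
    show "(\<lambda>u. (\<kappa> / om s) * (om u * x u)) summable_on UNIV"
      by (intro summable_on_cmult_right sum_le_summable[OF x])
    show "m s u * x u \<le> (\<kappa> / om s) * (om u * x u)" for u
      using mult_right_mono[OF mp(2)[of s u] xn[of u]] by simp
  qed (simp add: mp xn)
  show "(\<lambda>u. m s u * x u) summable_on UNIV" by (rule summ)
  show "sum_le (\<lambda>s. om s * (\<Sum>\<^sub>\<infinity>u. m s u * x u)) (\<kappa> * c)"
  proof (rule sum_leI)
    show "0 \<le> om s * (\<Sum>\<^sub>\<infinity>u. m s u * x u)" for s
      using o[of s] mp xn by (intro mult_nonneg_nonneg infsum_nonneg) auto
  next
    fix S :: "'a set" assume fin: "finite S"
    have "(\<Sum>s\<in>S. om s * (\<Sum>\<^sub>\<infinity>u. m s u * x u)) = (\<Sum>s\<in>S. \<Sum>\<^sub>\<infinity>u. om s * (m s u * x u))"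
      by (simp add: infsum_cmult_right')
    also have "\<dots> = (\<Sum>\<^sub>\<infinity>u. \<Sum>s\<in>S. om s * (m s u * x u))"
      by (rule infsumI[symmetric, OF has_sum_finite_sum[OF has_sum_infsum]]) (intro summable_on_cmult_right summ)
    also have "\<dots> \<le> (\<Sum>\<^sub>\<infinity>u. \<kappa> * (om u * x u))"
    proof (rule infsum_mono)
      show "(\<lambda>u. \<Sum>s\<in>S. om s * (m s u * x u)) summable_on UNIV"
        by (rule has_sum_imp_summable[OF has_sum_finite_sum[OF has_sum_infsum]]) (intro summable_on_cmult_right summ)
      show "(\<lambda>u. \<kappa> * (om u * x u)) summable_on UNIV"
        by (intro summable_on_cmult_right sum_le_summable[OF x])
      fix u
      have "(\<Sum>s\<in>S. om s * (m s u * x u)) = (\<Sum>s\<in>S. om s * m s u) * x u"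
        by (simp add: sum_distrib_right mult.assoc)
      also have "\<dots> \<le> (\<kappa> * om u) * x u"
        using m fin by (intro mult_right_mono xn) (simp add: colb_def sum_le_finite)
      finally show "(\<Sum>s\<in>S. om s * (m s u * x u)) \<le> \<kappa> * (om u * x u)" by simp
    qed
    also have "\<dots> = \<kappa> * (\<Sum>\<^sub>\<infinity>u. om u * x u)" by (simp add: infsum_cmult_right')
    also have "\<dots> \<le> \<kappa> * c" by (rule mult_left_mono[OF sum_le_infsum[OF x] mp(3)])
    finally show "(\<Sum>s\<in>S. om s * (\<Sum>\<^sub>\<infinity>u. m s u * x u)) \<le> \<kappa> * c" .
  qed
qed

section \<open>Matrix products and matrix families over a contour\<close>

text \<open>The formula of \<open>mat_mul\<close> over an arbitrary index type, because the locale
  of families below is polymorphic in it.\<close>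

definition mprod :: "('a \<Rightarrow> 'a \<Rightarrow> complex) \<Rightarrow> ('a \<Rightarrow> 'a \<Rightarrow> complex) \<Rightarrow> 'a \<Rightarrow> 'a \<Rightarrow> complex" where
  "mprod M N = (\<lambda>s r. \<Sum>\<^sub>\<infinity>u. M s u * N u r)"

primrec mpow :: "('a \<Rightarrow> 'a \<Rightarrow> complex) \<Rightarrow> nat \<Rightarrow> 'a \<Rightarrow> 'a \<Rightarrow> complex" where
  "mpow M 0 = (\<lambda>s r. if s = r then 1 else 0)"
| "mpow M (Suc n) = mprod M (mpow M n)"

lemma mat_mul_eq_mprod: "mat_mul = mprod"
  by (simp add: fun_eq_iff mat_mul_def mprod_def)

lemma mat_pow_eq_mpow: "mat_pow M n = mpow M n"
  by (induction n) (auto simp: mat_mul_eq_mprod mat_one_def)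

text \<open>\<open>Q\<close> is continuity on the contour in one instance, and in the other continuity on the closed disc
  together with holomorphy inside.\<close>

locale regular_family =
  fixes Z :: "complex set" and Q :: "(complex \<Rightarrow> complex) \<Rightarrow> bool" and om :: "'i \<Rightarrow> real"
  assumes Q_const: "Q (\<lambda>z. c)"
    and Q_add: "Q f \<Longrightarrow> Q g \<Longrightarrow> Q (\<lambda>z. f z + g z)"
    and Q_mult: "Q f \<Longrightarrow> Q g \<Longrightarrow> Q (\<lambda>z. f z * g z)"
    and Q_lim: "\<And>F :: 'i set \<Rightarrow> complex \<Rightarrow> complex. \<lbrakk>\<And>S. Q (F S);
        uniform_limit Z F g (finite_subsets_at_top UNIV)\<rbrakk> \<Longrightarrow> Q g"
    and om_ge: "1 \<le> om s"
begin

lemma om_pos: "0 < om s" and om_nonneg: "0 \<le> om s"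
  using om_ge[of s] by auto

lemma Q_diff: "Q f \<Longrightarrow> Q g \<Longrightarrow> Q (\<lambda>z. f z - g z)"
proof -
  assume "Q f" "Q g"
  from Q_add[OF this(1) Q_mult[OF Q_const[of "-1"] this(2)]] show ?thesis by simp
qed

lemma Q_sum:
  assumes "\<And>i. Q (f i)" shows "Q (\<lambda>z. \<Sum>i\<in>S. f i z)"
proof (induction S rule: infinite_finite_induct)
  case (insert x S)
  then show ?case using Q_add[OF assms insert.IH, of x] by simp
qed (simp_all add: Q_const)

lemma Q_infsum:
  fixes f :: "'i \<Rightarrow> complex \<Rightarrow> complex"
  assumes "\<And>u. Q (f u)" "\<And>u z. z \<in> Z \<Longrightarrow> cmod (f u z) \<le> g u" "g summable_on UNIV"
  shows "Q (\<lambda>z. \<Sum>\<^sub>\<infinity>u. f u z)"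
proof (rule Q_lim)
  show "uniform_limit Z (\<lambda>X z. \<Sum>x\<in>X. f x z) (\<lambda>z. \<Sum>\<^sub>\<infinity>u. f u z) (finite_subsets_at_top UNIV)"
    by (rule Weierstrass_m_test_general[OF assms(2,3)])
qed (rule Q_sum[OF assms(1)])

text \<open>One majorant serves all \<open>z\<close> in \<open>Z\<close>: by the Weierstrass test
  the infinite sums in products then converge uniformly, so \<open>Q\<close> survives
  multiplication. A separate norm bound for each \<open>z\<close> would not give this.\<close>

definition fam :: "(complex \<Rightarrow> 'i \<Rightarrow> 'i \<Rightarrow> complex) \<Rightarrow> real \<Rightarrow> bool" where
  "fam M \<kappa> \<longleftrightarrow> (\<forall>s r. Q (\<lambda>z. M z s r)) \<and>
     (\<exists>m. (\<forall>z\<in>Z. \<forall>s r. cmod (M z s r) \<le> m s r) \<and> colb om m \<kappa>)"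

text \<open>A trace-class type bound: on the diagonal the majorant is \<open>om s * d s\<close>, whose sum is at most \<open>c\<close>.\<close>

definition nfam :: "(complex \<Rightarrow> 'i \<Rightarrow> 'i \<Rightarrow> complex) \<Rightarrow> real \<Rightarrow> bool" where
  "nfam D c \<longleftrightarrow> (\<forall>s r. Q (\<lambda>z. D z s r)) \<and>
     (\<exists>d. (\<forall>z\<in>Z. \<forall>s r. cmod (D z s r) \<le> d s * om r) \<and> sum_le (\<lambda>s. om s * d s) c)"

lemma famI:
  assumes "\<And>s r. Q (\<lambda>z. M z s r)" "\<And>z s r. z \<in> Z \<Longrightarrow> cmod (M z s r) \<le> m s r" "colb om m \<kappa>"
  shows "fam M \<kappa>"
  unfolding fam_def by (intro conjI allI exI[of _ m] ballI assms)

lemma nfamI: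
  assumes "\<And>s r. Q (\<lambda>z. D z s r)" "\<And>z s r. z \<in> Z \<Longrightarrow> cmod (D z s r) \<le> d s * om r"
    "sum_le (\<lambda>s. om s * d s) c"
  shows "nfam D c"
  unfolding nfam_def by (intro conjI allI exI[of _ d] ballI assms)

lemma fam_Q: "fam M \<kappa> \<Longrightarrow> Q (\<lambda>z. M z s r)"
  unfolding fam_def by (elim conjE allE)

lemma nfam_Q: "nfam M \<kappa> \<Longrightarrow> Q (\<lambda>z. M z s r)"
  unfolding nfam_def by (elim conjE allE)

lemma fam_mono:
  assumes "fam M \<kappa>" "\<kappa> \<le> \<kappa>'" shows "fam M \<kappa>'"
proof -
  obtain m where m: "\<forall>z\<in>Z. \<forall>s r. cmod (M z s r) \<le> m s r" "colb om m \<kappa>"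
    using assms(1) unfolding fam_def by (elim conjE exE)
  have "colb om m \<kappa>'" unfolding colb_def
  proof
    fix r show "sum_le (\<lambda>s. om s * m s r) (\<kappa>' * om r)"
      using m(2) mult_right_mono[OF assms(2) om_nonneg[of r]]
      by - (rule sum_le_mono[of "\<lambda>s. om s * m s r"], auto simp: colb_def sum_le_def)
  qed
  with m show ?thesis by (intro famI[OF fam_Q[OF assms(1)], where m = m]) auto
qed

lemma fam_cong:
  assumes "fam M \<kappa>" "\<And>z. z \<in> Z \<Longrightarrow> M z = N z" "\<And>s r. Q (\<lambda>z. N z s r)"
  shows "fam N \<kappa>"
proof -
  obtain m where "\<forall>z\<in>Z. \<forall>s r. cmod (M z s r) \<le> m s r" "colb om m \<kappa>"
    using assms(1) unfolding fam_def by (elim conjE exE)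
  then show ?thesis using assms(2) by (intro famI[OF assms(3), where m = m]) auto
qed

lemma fam_add:
  assumes "fam M a" "fam N b" shows "fam (\<lambda>z s r. M z s r + N z s r) (a + b)"
proof -
  obtain m n where m: "\<forall>z\<in>Z. \<forall>s r. cmod (M z s r) \<le> m s r" "colb om m a"
    and n: "\<forall>z\<in>Z. \<forall>s r. cmod (N z s r) \<le> n s r" "colb om n b"
    using assms by (auto simp: fam_def)
  have "colb om (\<lambda>s r. m s r + n s r) (a + b)"
    using m(2) n(2) unfolding colb_def by (auto simp: ring_distribs intro!: sum_le_add)
  moreover have "\<forall>z\<in>Z. \<forall>s r. cmod (M z s r + N z s r) \<le> m s r + n s r"
    using m n by (meson add_mono norm_triangle_ineq order_trans)
  ultimately show ?thesis
    using fam_Q[OF assms(1)] fam_Q[OF assms(2)] by (intro famI[where m = "\<lambda>s r. m s r + n s r"] Q_add) auto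
qed

lemma fam_uminus:
  assumes "fam M a" shows "fam (\<lambda>z s r. - M z s r) a"
proof -
  have "Q (\<lambda>z. - M z s r)" for s r
    using Q_diff[OF Q_const[of 0] fam_Q[OF assms]] by simp
  moreover obtain m where m: "\<forall>z\<in>Z. \<forall>s r. cmod (M z s r) \<le> m s r" "colb om m a"
    using assms unfolding fam_def by (elim conjE exE)
  ultimately show ?thesis by (intro famI[where m = m]) simp_all
qed

lemma fam_diff:
  assumes "fam M a" "fam N b" shows "fam (\<lambda>z s r. M z s r - N z s r) (a + b)"
  using fam_add[OF assms(1) fam_uminus[OF assms(2)]] by simp

lemma fam_mul_summable:
  assumes "fam M a" "fam N b" "z \<in> Z" shows "(\<lambda>u. M z s u * N z u r) summable_on UNIV"
proof -
  obtain m n where m: "\<forall>z\<in>Z. \<forall>s r. cmod (M z s r) \<le> m s r" "colb om m a"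
    and n: "\<forall>z\<in>Z. \<forall>s r. cmod (N z s r) \<le> n s r" "colb om n b"
    using assms by (auto simp: fam_def)
  have "(\<lambda>u. m s u * n u r) summable_on UNIV"
    using majorant_apply(1)[OF m(2) om_ge, of "\<lambda>u. n u r"] n(2) colb_point[OF n(2) om_ge]
    by (auto simp: colb_def)
  then have "(\<lambda>u. norm (M z s u * N z u r)) summable_on UNIV"
    by (rule summable_on_comparison_test)
      (use assms(3) m n colb_point[OF m(2) om_ge] in \<open>auto simp: norm_mult intro!: mult_mono\<close>)
  then show ?thesis by (rule abs_summable_summable)
qed

lemma
  assumes "\<forall>z\<in>Z. \<forall>s r. cmod (M z s r) \<le> m s r" "colb om m \<kappa>" "\<And>s r. Q (\<lambda>z. M z s r)"
    "\<forall>z\<in>Z. \<forall>u. cmod (X z u) \<le> x u" "sum_le (\<lambda>u. om u * x u) c" "\<And>u. Q (\<lambda>z. X z u)"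
  shows Q_apply: "Q (\<lambda>z. \<Sum>\<^sub>\<infinity>u. M z s u * X z u)"
    and bound_apply: "\<And>z. z \<in> Z \<Longrightarrow> cmod (\<Sum>\<^sub>\<infinity>u. M z s u * X z u) \<le> (\<Sum>\<^sub>\<infinity>u. m s u * x u)"
    and sum_le_apply: "sum_le (\<lambda>s. om s * (\<Sum>\<^sub>\<infinity>u. m s u * x u)) (\<kappa> * c)"
proof -
  have xn: "0 \<le> x u" for u
    using sum_le_nonneg[OF assms(5), of u] om_pos[of u] by (simp add: zero_le_mult_iff)
  note mp = colb_point[OF assms(2) om_ge]
  have summ: "(\<lambda>u. m s u * x u) summable_on UNIV" for s
    by (rule majorant_apply(1)[OF assms(2) om_ge assms(5) xn])
  have le: "cmod (M z s u * X z u) \<le> m s u * x u" if "z \<in> Z" for z u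
    using assms that mp by (auto simp: norm_mult intro!: mult_mono)
  show "Q (\<lambda>z. \<Sum>\<^sub>\<infinity>u. M z s u * X z u)"
    by (rule Q_infsum[OF _ le summ]) (rule Q_mult[OF assms(3) assms(6)])
  show "cmod (\<Sum>\<^sub>\<infinity>u. M z s u * X z u) \<le> (\<Sum>\<^sub>\<infinity>u. m s u * x u)" if "z \<in> Z" for z
    by (rule sum_le_abs_summable(2)[OF sum_le_of_summable[OF summ _ order_refl] le[OF that]])
      (simp add: mp xn)
  show "sum_le (\<lambda>s. om s * (\<Sum>\<^sub>\<infinity>u. m s u * x u)) (\<kappa> * c)"
    by (rule majorant_apply(2)[OF assms(2) om_ge assms(5) xn])
qed

lemma fam_mul:
  assumes "fam M a" "fam N b" shows "fam (\<lambda>z. mprod (M z) (N z)) (a * b)"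
proof -
  obtain m n where m: "\<forall>z\<in>Z. \<forall>s r. cmod (M z s r) \<le> m s r" "colb om m a"
    and n: "\<forall>z\<in>Z. \<forall>s r. cmod (N z s r) \<le> n s r" "colb om n b"
    and Q: "\<And>s r. Q (\<lambda>z. M z s r)" "\<And>s r. Q (\<lambda>z. N z s r)"
    using assms by (auto simp: fam_def)
  have n1: "\<forall>z\<in>Z. \<forall>u. cmod (N z u r) \<le> n u r" for r using n by blast
  have n2: "sum_le (\<lambda>u. om u * n u r) (b * om r)" for r using n by (simp add: colb_def)
  show ?thesis
  proof (rule famI)
    show "Q (\<lambda>z. mprod (M z) (N z) s r)" for s r
      unfolding mprod_def by (rule Q_apply[OF m Q(1) n1 n2 Q(2)])
    show "cmod (mprod (M z) (N z) s r) \<le> (\<Sum>\<^sub>\<infinity>u. m s u * n u r)" if "z \<in> Z" for z s r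
      unfolding mprod_def by (rule bound_apply[OF m Q(1) n1 n2 Q(2) that])
    show "colb om (\<lambda>s r. \<Sum>\<^sub>\<infinity>u. m s u * n u r) (a * b)"
      unfolding colb_def using sum_le_apply[OF m Q(1) n1 n2 Q(2)] by (simp add: mult.assoc)
  qed
qed

text \<open>The majorant \<open>d s * om r\<close> has rank one and multiplication from the left
  acts on \<open>d\<close> alone, so these families behave like a left ideal.\<close>

lemma nfam_mul:
  assumes "fam M a" "nfam D c" shows "nfam (\<lambda>z. mprod (M z) (D z)) (a * c)"
proof -
  obtain m d where m: "\<forall>z\<in>Z. \<forall>s r. cmod (M z s r) \<le> m s r" "colb om m a"
    and d: "\<forall>z\<in>Z. \<forall>s r. cmod (D z s r) \<le> d s * om r" "sum_le (\<lambda>s. om s * d s) c"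
    and Q: "\<And>s r. Q (\<lambda>z. M z s r)" "\<And>s r. Q (\<lambda>z. D z s r)"
    using assms by (auto simp: fam_def nfam_def)
  have n1: "\<forall>z\<in>Z. \<forall>u. cmod (D z u r) \<le> d u * om r" for r using d by blast
  have n2: "sum_le (\<lambda>u. om u * (d u * om r)) (om r * c)" for r
    using sum_le_cmult[OF d(2) om_nonneg[of r]] by (simp add: mult_ac)
  have e: "(\<Sum>\<^sub>\<infinity>u. m s u * (d u * om r)) = (\<Sum>\<^sub>\<infinity>u. m s u * d u) * om r" for s r
    by (simp add: infsum_cmult_left' flip: mult.assoc)
  have dn: "0 \<le> d u" for u
    using sum_le_nonneg[OF d(2), of u] om_pos[of u] by (simp add: zero_le_mult_iff)
  show ?thesis
  proof (rule nfamI)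
    show "Q (\<lambda>z. mprod (M z) (D z) s r)" for s r
      unfolding mprod_def by (rule Q_apply[OF m Q(1) n1 n2 Q(2)])
    show "cmod (mprod (M z) (D z) s r) \<le> (\<Sum>\<^sub>\<infinity>u. m s u * d u) * om r" if "z \<in> Z" for z s r
      unfolding mprod_def e[symmetric] by (rule bound_apply[OF m Q(1) n1 n2 Q(2) that])
    show "sum_le (\<lambda>s. om s * (\<Sum>\<^sub>\<infinity>u. m s u * d u)) (a * c)"
      by (rule majorant_apply(2)[OF m(2) om_ge d(2) dn])
  qed
qed

lemma nfam_add:
  assumes "nfam M a" "nfam N b" shows "nfam (\<lambda>z s r. M z s r + N z s r) (a + b)"
proof -
  obtain m n where m: "\<forall>z\<in>Z. \<forall>s r. cmod (M z s r) \<le> m s * om r" "sum_le (\<lambda>s. om s * m s) a"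
    and n: "\<forall>z\<in>Z. \<forall>s r. cmod (N z s r) \<le> n s * om r" "sum_le (\<lambda>s. om s * n s) b"
    using assms by (auto simp: nfam_def)
  have "sum_le (\<lambda>s. om s * (m s + n s)) (a + b)"
    using sum_le_add[OF m(2) n(2)] by (simp add: ring_distribs)
  moreover have "\<forall>z\<in>Z. \<forall>s r. cmod (M z s r + N z s r) \<le> (m s + n s) * om r"
  proof (intro ballI allI)
    fix z s r assume "z \<in> Z"
    then have "cmod (M z s r) \<le> m s * om r" "cmod (N z s r) \<le> n s * om r" using m n by auto
    then show "cmod (M z s r + N z s r) \<le> (m s + n s) * om r"
      using norm_triangle_ineq[of "M z s r" "N z s r"] by (simp add: distrib_right)
  qed
  ultimately show ?thesis
    using nfam_Q[OF assms(1)] nfam_Q[OF assms(2)] by (intro nfamI[where d = "\<lambda>s. m s + n s"] Q_add) auto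
qed

lemma fam_one: "fam (\<lambda>z. \<lambda>s r. if s = r then 1 else 0) 1"
proof -
  have "sum_le (\<lambda>s. om s * (if s = r then 1 else 0)) (om r)" for r
    by (rule sum_leI) (auto simp: om_nonneg if_distrib[of "\<lambda>x. _ * x"] cong: if_cong)
  then show ?thesis
    by (intro famI[where m = "\<lambda>s r. if s = r then 1 else 0"]) (auto simp: colb_def Q_const)
qed

lemma fam_pow: "fam M a \<Longrightarrow> fam (\<lambda>z. mpow (M z) n) (a ^ n)"
proof (induction n)
  case (Suc n)
  then show ?case using fam_mul[OF Suc.prems Suc.IH] by simp
qed (simp add: fam_one)

text \<open>The noncommutative product rule. With \<open>M\<close> a power of \<open>K\<close>, this
  arrangement puts \<open>K - L\<close> directly in front of a power of \<open>K\<close>, the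
  product that \<open>nfam_block_rows\<close> later evaluates.\<close>

lemma mprod_telescope:
  assumes "fam K a" "fam L b" "fam M c" "fam N d" "z \<in> Z"
  shows "mprod (K z) (M z) s r - mprod (L z) (N z) s r =
    mprod (L z) (\<lambda>s r. M z s r - N z s r) s r + mprod (\<lambda>s r. K z s r - L z s r) (M z) s r"
proof -
  note su = fam_mul_summable[OF _ _ assms(5)]
  have s: "(\<lambda>u. L z s u * (M z u r - N z u r)) summable_on UNIV"
    "(\<lambda>u. (K z s u - L z s u) * M z u r) summable_on UNIV"
    using su[OF assms(2) fam_diff[OF assms(3,4)]] su[OF fam_diff[OF assms(1,2)] assms(3)] by auto
  show ?thesis unfolding mprod_def
    using infsum_add[OF s] infsum_minus[OF su[OF assms(1,3)] su[OF assms(2,4)], of s r]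
    by (simp add: algebra_simps)
qed

lemma fam_pow_diff:
  assumes "fam K a" "fam L a" "fam (\<lambda>z s r. K z s r - L z s r) e"
  shows "fam (\<lambda>z s r. mpow (K z) n s r - mpow (L z) n s r) (real n * a ^ (n - 1) * e)"
proof (induction n)
  case 0
  have "fam (\<lambda>z. (\<lambda>s r. 0)) 0"
    by (rule famI[where m = "\<lambda>s r. 0"]) (auto simp: colb_def sum_le_def Q_const)
  then show ?case by simp
next
  case (Suc n)
  have n1: "fam (\<lambda>z. mprod (L z) (\<lambda>s r. mpow (K z) n s r - mpow (L z) n s r)) (a * (real n * a ^ (n - 1) * e))"
    by (rule fam_mul[OF assms(2) Suc])
  have n2: "fam (\<lambda>z. mprod (\<lambda>s r. K z s r - L z s r) (mpow (K z) n)) (e * a ^ n)"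
    by (rule fam_mul[OF assms(3) fam_pow[OF assms(1)]])
  have Q: "Q (\<lambda>z. mpow (K z) (Suc n) s r - mpow (L z) (Suc n) s r)" for s r
    by (rule Q_diff[OF fam_Q[OF fam_pow[OF assms(1)]] fam_Q[OF fam_pow[OF assms(2)]]])
  \<comment> \<open>At \<open>n = 0\<close> the truncated exponent \<open>n - 1\<close> is harmless
    because of the factor \<open>real n\<close>; hence the case split.\<close>
  have "a * (real n * a ^ (n - 1) * e) + e * a ^ n = real (Suc n) * a ^ (Suc n - 1) * e"
    by (cases n) (auto simp: algebra_simps)
  then have "fam (\<lambda>z s r. mprod (L z) (\<lambda>s r. mpow (K z) n s r - mpow (L z) n s r) s r +
       mprod (\<lambda>s r. K z s r - L z s r) (mpow (K z) n) s r) (real (Suc n) * a ^ (Suc n - 1) * e)"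
    using fam_add[OF n1 n2] by (simp only:)
  then show ?case
  proof (rule fam_cong)
    fix z assume "z \<in> Z"
    then show "(\<lambda>s r. mprod (L z) (\<lambda>s r. mpow (K z) n s r - mpow (L z) n s r) s r +
        mprod (\<lambda>s r. K z s r - L z s r) (mpow (K z) n) s r) =
      (\<lambda>s r. mpow (K z) (Suc n) s r - mpow (L z) (Suc n) s r)"
      by (simp add: fun_eq_iff mprod_telescope[OF assms(1,2) fam_pow[OF assms(1)] fam_pow[OF assms(2)]])
  qed (rule Q)
qed

lemma nfam_cong:
  assumes "nfam M \<kappa>" "\<And>z. z \<in> Z \<Longrightarrow> M z = N z" "\<And>s r. Q (\<lambda>z. N z s r)"
  shows "nfam N \<kappa>"
proof -
  obtain d where "\<forall>z\<in>Z. \<forall>s r. cmod (M z s r) \<le> d s * om r" "sum_le (\<lambda>s. om s * d s) \<kappa>"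
    using assms(1) unfolding nfam_def by (elim conjE exE)
  then show ?thesis using assms(2) by (intro nfamI[OF assms(3), where d = d]) auto
qed

text \<open>Each of the \<open>n\<close> telescoped terms has powers of \<open>L\<close>, one factor
  \<open>K - L\<close>, then powers of \<open>K\<close>. The hypothesis covers the last two, and the
  powers of \<open>L\<close> in front keep the trace-type bound by \<open>nfam_mul\<close>.\<close>

lemma nfam_pow_diff:
  assumes K: "fam K a" and L: "fam L a"
    and B: "\<And>n. nfam (\<lambda>z. mprod (\<lambda>s r. K z s r - L z s r) (mpow (K z) n)) (c * a ^ Suc n)"
  shows "nfam (\<lambda>z s r. mpow (K z) n s r - mpow (L z) n s r) (real n * c * a ^ n)"
proof (induction n)
  case 0
  have "nfam (\<lambda>z. (\<lambda>s r. 0)) 0"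
    by (rule nfamI[where d = "\<lambda>s. 0"]) (auto simp: sum_le_def Q_const)
  then show ?case by simp
next
  case (Suc n)
  have n1: "nfam (\<lambda>z. mprod (L z) (\<lambda>s r. mpow (K z) n s r - mpow (L z) n s r)) (a * (real n * c * a ^ n))"
    by (rule nfam_mul[OF L Suc])
  have Q: "Q (\<lambda>z. mpow (K z) (Suc n) s r - mpow (L z) (Suc n) s r)" for s r
    by (rule Q_diff[OF fam_Q[OF fam_pow[OF K]] fam_Q[OF fam_pow[OF L]]])
  have "a * (real n * c * a ^ n) + c * a ^ Suc n = real (Suc n) * c * a ^ Suc n"
    by (auto simp: algebra_simps)
  then have "nfam (\<lambda>z s r. mprod (L z) (\<lambda>s r. mpow (K z) n s r - mpow (L z) n s r) s r +
       mprod (\<lambda>s r. K z s r - L z s r) (mpow (K z) n) s r) (real (Suc n) * c * a ^ Suc n)"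
    using nfam_add[OF n1 B[of n]] by (simp only:)
  then show ?case
  proof (rule nfam_cong)
    fix z assume "z \<in> Z"
    then show "(\<lambda>s r. mprod (L z) (\<lambda>s r. mpow (K z) n s r - mpow (L z) n s r) s r +
        mprod (\<lambda>s r. K z s r - L z s r) (mpow (K z) n) s r) =
      (\<lambda>s r. mpow (K z) (Suc n) s r - mpow (L z) (Suc n) s r)"
      by (simp add: fun_eq_iff mprod_telescope[OF K L fam_pow[OF K] fam_pow[OF L]])
  qed (rule Q)
qed

end

subsection \<open>Absolutely convergent Fourier series\<close>

lemma rvec_simps [simp]:
  "rvec (m + n) = rvec m + rvec n" "rvec (m - n) = rvec m - rvec n" "rvec (- m) = - rvec m" "rvec 0 = 0"
  by (simp_all add: rvec_def prod_eq_iff)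

lemma norm_wave [simp]: "cmod (wave p x) = 1"
  by (simp add: wave_def)

lemma wave_add: "wave (p + p') x = wave p x * wave p' x"
  by (simp add: wave_def inner_add_left cis_mult)

lemma cnj_wave: "cnj (wave p x) = wave (- p) x"
  by (simp add: wave_def cis_cnj)

lemma continuous_on_wave [continuous_intros]: "continuous_on S (wave p)"
  unfolding wave_def[abs_def] by (intro continuous_intros)

lemma wave_periodic: "wave (rvec m) (x + (2 * pi) *\<^sub>R rvec n) = wave (rvec m) x"
proof -
  have "wave (rvec m) ((2 * pi) *\<^sub>R rvec n) = cis (2 * pi * of_int (fst m * fst n + snd m * snd n))"
    by (simp add: wave_def rvec_def inner_prod_def algebra_simps)
  also have "\<dots> = 1" by (rule cis_multiple_2pi) simp
  finally have "cis (rvec m \<bullet> ((2 * pi) *\<^sub>R rvec n)) = 1" by (simp add: wave_def)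
  then show ?thesis by (simp add: wave_def inner_add_right flip: cis_mult)
qed

lemma integral_cis:
  "integral (cbox 0 (2 * pi)) (\<lambda>x. cis (of_int n * x)) = (if n = 0 then 2 * pi else 0)"
proof (cases "n = 0")
  case False
  have "((\<lambda>x. cis (of_int n * x)) has_integral
      cis (of_int n * (2 * pi)) / (\<i> * of_int n) - cis (of_int n * 0) / (\<i> * of_int n)) {0..2 * pi}"
  proof (rule fundamental_theorem_of_calculus)
    fix x assume "x \<in> {0..2 * pi}"
    show "((\<lambda>x. cis (of_int n * x) / (\<i> * of_int n)) has_vector_derivative cis (of_int n * x))
        (at x within {0..2 * pi})"
    proof -
      have "((\<lambda>x. cis (of_int n * x)) has_derivative (\<lambda>t. (of_int n * t) *\<^sub>R (\<i> * cis (of_int n * x))))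
          (at x within {0..2 * pi})"
        by (intro has_derivative_cis has_derivative_mult_right has_derivative_ident)
      then have "((\<lambda>x. cis (of_int n * x) / (\<i> * of_int n)) has_derivative
          (\<lambda>t. ((of_int n * t) *\<^sub>R (\<i> * cis (of_int n * x))) / (\<i> * of_int n))) (at x within {0..2 * pi})"
        by (rule bounded_linear.has_derivative[OF bounded_linear_divide])
      moreover have "((of_int n * t) *\<^sub>R (\<i> * cis (of_int n * x))) / (\<i> * of_int n) =
          t *\<^sub>R cis (of_int n * x)" for t
        using False by (simp add: scaleR_conv_of_real field_simps)
      ultimately show ?thesis by (simp add: has_vector_derivative_def)
    qed
  qed simp
  moreover have "cis (of_int n * (2 * pi)) = 1"
    using cis_multiple_2pi[of "of_int n"] by (simp add: mult_ac)
  ultimately show ?thesis using False by (auto simp: box_real intro: integral_unique)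
qed (simp add: scaleR_conv_of_real)

lemma integral_wave:
  "integral (cbox (0, 0) (2 * pi, 2 * pi)) (wave (rvec m)) = (if m = 0 then complex_of_real ((2 * pi)\<^sup>2) else 0)"
proof -
  have "integral (cbox (0, 0) (2 * pi, 2 * pi)) (wave (rvec m)) =
      integral (cbox 0 (2 * pi)) (\<lambda>x. integral (cbox 0 (2 * pi)) (\<lambda>y. wave (rvec m) (x, y)))"
    by (rule integral_prod_continuous) (rule continuous_on_wave)
  also have "\<dots> = integral (cbox 0 (2 * pi)) (\<lambda>x. cis (of_int (fst m) * x) * integral (cbox 0 (2 * pi)) (\<lambda>y. cis (of_int (snd m) * y)))"
    by (simp add: wave_def rvec_def inner_prod_def flip: cis_mult)
  also have "\<dots> = integral (cbox 0 (2 * pi)) (\<lambda>x. cis (of_int (fst m) * x)) * integral (cbox 0 (2 * pi)) (\<lambda>y. cis (of_int (snd m) * y))"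
    by (rule integral_mult_left)
  also have "\<dots> = (if m = 0 then complex_of_real ((2 * pi)\<^sup>2) else 0)"
    unfolding integral_cis by (auto simp: prod_eq_iff power2_eq_square)
  finally show ?thesis .
qed

definition trig :: "(idx \<Rightarrow> complex) \<Rightarrow> plane \<Rightarrow> complex" where
  "trig a x = (\<Sum>\<^sub>\<infinity>m. a m * wave (rvec m) x)"

lemma trig_summable:
  assumes "sum_le (\<lambda>m. cmod (a m)) c" shows "(\<lambda>m. a m * wave (p m) x) summable_on UNIV"
  by (rule sum_le_abs_summable(1)[OF assms]) (simp add: norm_mult)

lemma trig_uniform_limit:
  assumes "sum_le (\<lambda>m. cmod (a m)) c"
  shows "uniform_limit S (\<lambda>X x. \<Sum>m\<in>X. a m * wave (rvec m) x) (trig a) (finite_subsets_at_top UNIV)"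
  unfolding trig_def[abs_def]
  by (rule Weierstrass_m_test_general[OF _ sum_le_summable[OF assms]]) (simp add: norm_mult)

lemma continuous_on_trig:
  assumes "sum_le (\<lambda>m. cmod (a m)) c" shows "continuous_on S (trig a)"
  by (rule uniform_limit_theorem[OF _ trig_uniform_limit[OF assms]])
    (auto intro!: continuous_intros always_eventually)

lemma periodic2_trig: "periodic2 (trig a)"
  by (simp add: periodic2_def trig_def wave_periodic)

text \<open>Uniform convergence on the square permits integration term by term, and the waves are
  orthogonal.\<close>

lemma fourier_trig:
  assumes "sum_le (\<lambda>m. cmod (a m)) c" shows "fourier (trig a) n = a n"
proof -
  let ?Q = "cbox (0, 0) (2 * pi, 2 * pi) :: plane set"
  let ?F = "finite_subsets_at_top (UNIV :: idx set)"
  have "uniform_limit ?Q (\<lambda>X x. (\<Sum>m\<in>X. a m * wave (rvec m) x) * wave (- rvec n) x)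
      (\<lambda>x. trig a x * wave (- rvec n) x) ?F"
  proof -
    have "uniform_limit ?Q (\<lambda>X x. \<Sum>m\<in>X. a m * wave (rvec m) x * wave (- rvec n) x)
        (\<lambda>x. \<Sum>\<^sub>\<infinity>m. a m * wave (rvec m) x * wave (- rvec n) x) ?F"
      by (rule Weierstrass_m_test_general[OF _ sum_le_summable[OF assms]]) (simp add: norm_mult)
    then show ?thesis
      by (simp only: sum_distrib_right infsum_cmult_left' trig_def)
  qed
  then obtain I J where IJ:
    "\<And>X. ((\<lambda>x. (\<Sum>m\<in>X. a m * wave (rvec m) x) * wave (- rvec n) x) has_integral I X) ?Q"
    "((\<lambda>x. trig a x * wave (- rvec n) x) has_integral J) ?Q" "(I \<longlongrightarrow> J) ?F"
    by (rule uniform_limit_integral_cbox) (auto intro!: continuous_intros)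
  have I: "I X = (if n \<in> X then a n * complex_of_real ((2 * pi)\<^sup>2) else 0)" if "finite X" for X
  proof -
    have "((\<lambda>x. \<Sum>m\<in>X. a m * wave (rvec (m - n)) x) has_integral
        (\<Sum>m\<in>X. a m * integral ?Q (wave (rvec (m - n))))) ?Q"
      by (intro has_integral_sum that has_integral_mult_right integrable_integral integrable_continuous continuous_on_wave)
    moreover have "(\<lambda>x. \<Sum>m\<in>X. a m * wave (rvec (m - n)) x) = (\<lambda>x. (\<Sum>m\<in>X. a m * wave (rvec m) x) * wave (- rvec n) x)"
      by (simp add: sum_distrib_right wave_add[of "rvec _" "- rvec n", simplified] mult.assoc)
    ultimately have "I X = (\<Sum>m\<in>X. a m * integral ?Q (wave (rvec (m - n))))"
      using has_integral_unique[OF IJ(1)[of X]] by simp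
    also have "\<dots> = (\<Sum>m\<in>X. if m = n then a n * complex_of_real ((2 * pi)\<^sup>2) else 0)"
      unfolding integral_wave by (intro sum.cong) auto
    finally show ?thesis using that by simp
  qed
  \<comment> \<open>The net of integrals is constant as soon as the finite set contains
    \<open>n\<close>.\<close>
  have "eventually (\<lambda>X. I X = a n * complex_of_real ((2 * pi)\<^sup>2)) ?F"
    unfolding eventually_finite_subsets_at_top by (intro exI[of _ "{n}"]) (auto simp: I)
  then have "(I \<longlongrightarrow> a n * complex_of_real ((2 * pi)\<^sup>2)) ?F" by (rule tendsto_eventually)
  then have "J = a n * complex_of_real ((2 * pi)\<^sup>2)"
    by (rule tendsto_unique[OF finite_subsets_at_top_neq_bot IJ(3)])
  then show ?thesis
    unfolding fourier_def using IJ(2) by (simp add: integral_unique)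
qed

lemma star_space_sum_le: "W \<in> star_space \<Longrightarrow> sum_le (\<lambda>m. cmod (fourier W m)) (star_norm W)"
  unfolding star_space_def star_norm_def by (intro sum_le_of_summable) auto

lemma star_norm_le: "sum_le (\<lambda>m. cmod (fourier W m)) c \<Longrightarrow> star_norm W \<le> c"
  unfolding star_norm_def by (rule sum_le_infsum)

lemma trig_star_space:
  assumes "sum_le (\<lambda>m. cmod (a m)) c" shows "trig a \<in> star_space" "star_norm (trig a) \<le> c"
proof -
  have "fourier (trig a) = a" using fourier_trig[OF assms] by auto
  then show "trig a \<in> star_space" "star_norm (trig a) \<le> c"
    using sum_le_summable[OF assms] sum_le_infsum[OF assms] continuous_on_trig[OF assms]
    by (auto simp: star_space_def star_norm_def periodic2_trig)
qed

lemma fourier_diff: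
  assumes "continuous_on UNIV f" "continuous_on UNIV g"
  shows "fourier (\<lambda>x. f x - g x) m = fourier f m - fourier g m"
proof -
  have i: "(\<lambda>x. h x * wave (- rvec m) x) integrable_on cbox (0, 0) (2 * pi, 2 * pi)"
    if "continuous_on UNIV h" for h
    using that by (intro integrable_continuous continuous_intros) (auto intro: continuous_on_subset)
  show ?thesis unfolding fourier_def
    using integral_diff[OF i[OF assms(1)] i[OF assms(2)]]
    by (simp add: left_diff_distrib diff_divide_distrib)
qed

lemma fourier_diff_star:
  "f \<in> star_space \<Longrightarrow> g \<in> star_space \<Longrightarrow> fourier (\<lambda>x. f x - g x) m = fourier f m - fourier g m"
  by (intro fourier_diff) (auto simp: star_space_def)

lemma fourier_uminus_real:
  assumes "\<And>x. V x \<in> \<real>" shows "fourier V (- m) = cnj (fourier V m)"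
proof -
  have "cnj (V x) = V x" for x using assms Reals_cnj_iff by blast
  then have "cnj (integral (cbox (0, 0) (2 * pi, 2 * pi)) (\<lambda>x. V x * wave (- rvec m) x)) =
     integral (cbox (0, 0) (2 * pi, 2 * pi)) (\<lambda>x. V x * wave (rvec m) x)"
    by (simp add: integral_cnj cnj_wave)
  then show ?thesis by (simp add: fourier_def)
qed

lemma finite_lattice_ball: "finite {m. norm (rvec m) \<le> R}"
proof (rule finite_subset)
  show "{m. norm (rvec m) \<le> R} \<subseteq> {-\<lceil>R\<rceil>..\<lceil>R\<rceil>} \<times> {-\<lceil>R\<rceil>..\<lceil>R\<rceil>}"
  proof
    fix m assume "m \<in> {m. norm (rvec m) \<le> R}"
    then have n: "norm (rvec m) \<le> R" by simp
    have "\<bar>real_of_int (fst m)\<bar> \<le> norm (rvec m)" "\<bar>real_of_int (snd m)\<bar> \<le> norm (rvec m)"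
      by (simp_all add: rvec_def norm_Pair)
    with n have "\<bar>real_of_int (fst m)\<bar> \<le> R" "\<bar>real_of_int (snd m)\<bar> \<le> R" by auto
    then have "\<bar>fst m\<bar> \<le> \<lceil>R\<rceil>" "\<bar>snd m\<bar> \<le> \<lceil>R\<rceil>"
      by (metis ceiling_mono ceiling_of_int of_int_abs)+
    then show "m \<in> {-\<lceil>R\<rceil>..\<lceil>R\<rceil>} \<times> {-\<lceil>R\<rceil>..\<lceil>R\<rceil>}" by (cases m) auto
  qed
qed simp

lemma sum_le_finite_support:
  fixes v :: "'a \<Rightarrow> complex"
  assumes "finite S" shows "sum_le (\<lambda>m. cmod (if m \<in> S then v m else 0)) (\<Sum>m\<in>S. cmod (v m))"
proof (rule sum_leI)
  fix T :: "'a set" assume "finite T"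
  then have "(\<Sum>m\<in>T. cmod (if m \<in> S then v m else 0)) = (\<Sum>m\<in>T \<inter> S. cmod (v m))"
    by (simp add: sum.inter_restrict if_distrib cong: if_cong)
  also have "\<dots> \<le> (\<Sum>m\<in>S. cmod (v m))" by (rule sum_mono2[OF assms]) auto
  finally show "(\<Sum>m\<in>T. cmod (if m \<in> S then v m else 0)) \<le> (\<Sum>m\<in>S. cmod (v m))" .
qed simp

text \<open>The vanishing mean keeps \<open>V\<close> out of the diagonal of the model block, the
  conjugate symmetry makes the block Hermitian, and the support bound limits the length of
  \<open>q\<close> in the level curve estimate.\<close>

lemma
  assumes "trig_potential R V"
  shows trig_potential_star: "V \<in> star_space"
    and trig_potential_trig: "V = trig (fourier V)"
    and trig_potential_0: "fourier V 0 = 0"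
    and trig_potential_support: "fourier V q \<noteq> 0 \<Longrightarrow> norm (rvec q) \<le> R"
    and trig_potential_cnj: "fourier V (- m) = cnj (fourier V m)"
proof -
  let ?S = "{m. 0 < norm (rvec m) \<and> norm (rvec m) \<le> R}"
  obtain v where v: "V = (\<lambda>x. \<Sum>m\<in>?S. v m * wave (rvec m) x)" and r: "\<And>x. V x \<in> \<real>"
    using assms unfolding trig_potential_def by blast
  have fin: "finite ?S" by (rule finite_subset[OF _ finite_lattice_ball[of R]]) auto
  define a where "a m = (if m \<in> ?S then v m else 0)" for m
  have a: "sum_le (\<lambda>m. cmod (a m)) (\<Sum>m\<in>?S. cmod (v m))"
    unfolding a_def by (rule sum_le_finite_support[OF fin])
  have V: "V = trig a"
  proof
    fix x
    have "trig a x = (\<Sum>\<^sub>\<infinity>m\<in>?S. v m * wave (rvec m) x)"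
      unfolding trig_def a_def by (rule infsum_cong_neutral) auto
    also have "\<dots> = V x" using fin by (simp add: v)
    finally show "V x = trig a x" ..
  qed
  have f: "fourier V = a" using fourier_trig[OF a] V by auto
  show "V \<in> star_space" using trig_star_space[OF a] V by simp
  show "V = trig (fourier V)" using V f by simp
  show "fourier V 0 = 0" "fourier V q \<noteq> 0 \<Longrightarrow> norm (rvec q) \<le> R" unfolding f by (auto simp: a_def split: if_splits)
  show "fourier V (- m) = cnj (fourier V m)" by (rule fourier_uminus_real[OF r])
qed

section \<open>Correlations of summable coefficient sequences\<close>

definition corr :: "(idx \<Rightarrow> complex) \<Rightarrow> (idx \<Rightarrow> complex) \<Rightarrow> idx \<Rightarrow> complex" where
  "corr e f m = (\<Sum>\<^sub>\<infinity>r. e (m + r) * cnj (f r))"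

text \<open>The matrix with entries \<open>e (m + r)\<close> has column norm at most
  \<open>c\<close> for the constant weight 1, so \<open>majorant_apply\<close> becomes Young's
  inequality for l1. The product formula follows by exchanging an absolutely convergent double
  sum.\<close>

lemma
  assumes e: "sum_le (\<lambda>m. cmod (e m)) c" and f: "sum_le (\<lambda>m. cmod (f m)) d"
  shows corr_summable: "(\<lambda>r. e (m + r) * cnj (f r)) summable_on UNIV"
    and sum_le_corr: "sum_le (\<lambda>m. cmod (corr e f m)) (c * d)"
    and trig_corr: "trig (corr e f) x = trig e x * cnj (trig f x)"
proof -
  have col: "colb (\<lambda>s. 1) (\<lambda>s r. cmod (e (s + r))) c"
    unfolding colb_def
  proof
    have "inj (\<lambda>s. s + r)" for r :: idx by (simp add: inj_def)
    from sum_le_comp_inj[OF e this] show "sum_le (\<lambda>s. 1 * cmod (e (s + r))) (c * 1)" for r by simp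
  qed
  note ma = majorant_apply[OF col _ , of "\<lambda>r. cmod (f r)" d, simplified, OF f]
  have abs: "(\<lambda>r. norm (e (m + r) * cnj (f r))) summable_on UNIV" for m
    using ma(1)[of m] by (simp add: norm_mult)
  show su: "(\<lambda>r. e (m + r) * cnj (f r)) summable_on UNIV" for m
    by (rule abs_summable_summable[OF abs])
  show sl: "sum_le (\<lambda>m. cmod (corr e f m)) (c * d)"
  proof (rule sum_le_mono[OF ma(2)])
    show "cmod (corr e f m) \<le> (\<Sum>\<^sub>\<infinity>r. cmod (e (m + r)) * cmod (f r))" for m
      using norm_infsum_bound[OF abs[of m]] by (simp add: corr_def norm_mult)
  qed auto
  let ?h = "\<lambda>m r. e (m + r) * cnj (f r) * wave (rvec m) x"
  have "(\<lambda>p. norm (case p of (m, r) \<Rightarrow> ?h m r)) summable_on UNIV \<times> UNIV"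
  proof (subst Infinite_Sum.abs_summable_on_Sigma_iff, intro conjI ballI)
    show "(\<lambda>r. norm (case (m, r) of (m, r) \<Rightarrow> ?h m r)) summable_on UNIV" for m
      using abs[of m] by (simp add: norm_mult)
    show "(\<lambda>m. norm (\<Sum>\<^sub>\<infinity>r. norm (case (m, r) of (m, r) \<Rightarrow> ?h m r))) summable_on UNIV"
      using sum_le_summable[OF ma(2)] by (simp add: norm_mult infsum_nonneg)
  qed
  then have "(\<Sum>\<^sub>\<infinity>m. \<Sum>\<^sub>\<infinity>r. ?h m r) = (\<Sum>\<^sub>\<infinity>r. \<Sum>\<^sub>\<infinity>m. ?h m r)"
    by (intro infsum_swap_banach) (rule abs_summable_summable)
  also have "\<dots> = (\<Sum>\<^sub>\<infinity>r. trig e x * cnj (f r * wave (rvec r) x))"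
  proof (rule infsum_cong)
    fix r
    have "(\<Sum>\<^sub>\<infinity>m. ?h m r) = (\<Sum>\<^sub>\<infinity>m. e (m + r) * wave (rvec (m + r)) x * cnj (f r * wave (rvec r) x))"
    proof (rule infsum_cong)
      fix m
      have "wave (rvec (m + r)) x * cnj (wave (rvec r) x) = wave (rvec m) x"
        by (simp add: cnj_wave flip: wave_add)
      then show "?h m r = e (m + r) * wave (rvec (m + r)) x * cnj (f r * wave (rvec r) x)"
        by (simp add: mult_ac)
    qed
    also have "\<dots> = (\<Sum>\<^sub>\<infinity>m. e (m + r) * wave (rvec (m + r)) x) * cnj (f r * wave (rvec r) x)"
      by (rule infsum_cmult_left')
    also have "(\<Sum>\<^sub>\<infinity>m. e (m + r) * wave (rvec (m + r)) x) = trig e x"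
      unfolding trig_def by (rule infsum_reindex_bij_betw) (rule bij_plus_right)
    finally show "(\<Sum>\<^sub>\<infinity>m. ?h m r) = trig e x * cnj (f r * wave (rvec r) x)" .
  qed
  also have "\<dots> = trig e x * cnj (trig f x)"
    by (simp only: infsum_cmult_right' infsum_cnj trig_def)
  finally show "trig (corr e f) x = trig e x * cnj (trig f x)"
    by (simp add: trig_def corr_def infsum_cmult_left')
qed

text \<open>Sesquilinearity: the difference is \<open>corr e (e - f) + corr (e - f) f\<close>. This
  supplies the Lipschitz bound for the quadratic nonlinearity.\<close>

lemma sum_le_corr_diff:
  assumes e: "sum_le (\<lambda>m. cmod (e m)) c" and f: "sum_le (\<lambda>m. cmod (f m)) c"
    and d: "sum_le (\<lambda>m. cmod (e m - f m)) d"
  shows "sum_le (\<lambda>m. cmod (corr e e m - corr f f m)) (2 * c * d)"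
proof -
  let ?d = "\<lambda>m. e m - f m"
  have eq: "corr e e m - corr f f m = corr e ?d m + corr ?d f m" for m
  proof -
    note s = corr_summable[OF e d, of m] corr_summable[OF d f, of m]
      corr_summable[OF e e, of m] corr_summable[OF f f, of m]
    show ?thesis unfolding corr_def
      using infsum_add[OF s(1,2)] infsum_minus[OF s(3,4)] by (simp add: algebra_simps)
  qed
  have "sum_le (\<lambda>m. cmod (corr e ?d m) + cmod (corr ?d f m)) (c * d + d * c)"
    by (intro sum_le_add sum_le_corr e f d)
  then show ?thesis
    by (rule sum_le_mono) (auto simp: eq norm_triangle_ineq)
qed

subsection \<open>Resolvent of the model operator\<close>

lemma infsum_two:
  fixes f :: "'a \<Rightarrow> complex"
  assumes "a \<noteq> b" "\<And>u. u \<noteq> a \<Longrightarrow> u \<noteq> b \<Longrightarrow> f u = 0" shows "infsum f UNIV = f a + f b"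
proof -
  have "infsum f UNIV = infsum f {a, b}" by (rule infsum_cong_neutral) (use assms(2) in auto)
  then show ?thesis using assms(1) by simp
qed

lemma infsum_one:
  fixes f :: "'a \<Rightarrow> complex"
  assumes "\<And>u. u \<noteq> a \<Longrightarrow> f u = 0" shows "infsum f UNIV = f a"
proof -
  have "infsum f UNIV = infsum f {a}" by (rule infsum_cong_neutral) (use assms in auto)
  then show ?thesis by simp
qed

text \<open>The distance to \<open>z\<close> is convex along the real axis, so on an interval it is
  largest at an endpoint. It will be used for the diagonal entries of the block, which lie between
  the two eigenvalues.\<close>

lemma convex_comb_norm_le:
  fixes z :: complex
  assumes "a \<le> x" "x \<le> b"
  shows "cmod (of_real x - z) \<le> max (cmod (of_real a - z)) (cmod (of_real b - z))"
proof -
  have "x \<in> closed_segment a b" using assms by (simp add: closed_segment_eq_real_ivl)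
  then obtain u where u: "0 \<le> u" "u \<le> 1" "x = (1 - u) * a + u * b"
    by (auto simp: closed_segment_def)
  let ?M = "max (cmod (of_real a - z)) (cmod (of_real b - z))"
  have "of_real x - z = of_real (1 - u) * (of_real a - z) + of_real u * (of_real b - z)"
    by (simp add: u(3) algebra_simps)
  then have "cmod (of_real x - z) \<le> (1 - u) * cmod (of_real a - z) + u * cmod (of_real b - z)"
    using u by (metis norm_triangle_ineq norm_mult norm_of_real abs_of_nonneg diff_ge_0_iff_ge)
  also have "\<dots> \<le> (1 - u) * ?M + u * ?M" using u by (intro add_mono mult_left_mono) auto
  finally show ?thesis by (simp add: algebra_simps)
qed

text \<open>The product is maximum times minimum, so the numerator cancels the larger factor. Thus
  an entry of the inverse block costs one inverse distance to the spectrum,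
  \<open>1 / \<epsilon>^10\<close>, although the determinant contains two.\<close>

lemma quotient_max_bound:
  fixes e a b \<eta> :: real
  assumes "0 < \<eta>" "\<eta> \<le> a" "\<eta> \<le> b" "0 \<le> e" "e \<le> max a b"
  shows "e / (a * b) \<le> 1 / \<eta>"
proof -
  have "e * \<eta> \<le> max a b * min a b" using assms by (intro mult_mono) auto
  also have "\<dots> = a * b" by (simp add: max_def min_def)
  finally show ?thesis using assms by (simp add: field_simps)
qed

text \<open>A two-by-two block on \<open>a\<close>, \<open>b\<close> and a diagonal elsewhere. Each
  row and column has at most two nonzero entries, so products with arbitrary matrices are finite
  sums and raise no convergence question.\<close>

definition blockm :: "'a \<Rightarrow> 'a \<Rightarrow> complex \<Rightarrow> complex \<Rightarrow> complex \<Rightarrow> complex \<Rightarrow> ('a \<Rightarrow> complex) \<Rightarrow> 'a \<Rightarrow> 'a \<Rightarrow> complex" where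
  "blockm a b x11 x12 x21 x22 f s r =
     (if s = a then if r = a then x11 else if r = b then x12 else 0
      else if s = b then if r = a then x21 else if r = b then x22 else 0
      else if s = r then f s else 0)"

lemma mprod_blockm_left:
  assumes "a \<noteq> b"
  shows "mprod (blockm a b x11 x12 x21 x22 f) N s r =
    (if s = a then x11 * N a r + x12 * N b r else if s = b then x21 * N a r + x22 * N b r else f s * N s r)"
proof -
  let ?M = "blockm a b x11 x12 x21 x22 f"
  have "(\<Sum>\<^sub>\<infinity>u. ?M s u * N u r) = ?M s a * N a r + ?M s b * N b r" if "s = a \<or> s = b"
    by (rule infsum_two[OF assms]) (use that in \<open>auto simp: blockm_def\<close>)
  moreover have "(\<Sum>\<^sub>\<infinity>u. ?M s u * N u r) = ?M s s * N s r" if "s \<noteq> a" "s \<noteq> b"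
    by (rule infsum_one) (use that in \<open>auto simp: blockm_def\<close>)
  ultimately show ?thesis using assms by (auto simp: mprod_def blockm_def)
qed

lemma mprod_blockm_right:
  assumes "a \<noteq> b"
  shows "mprod N (blockm a b x11 x12 x21 x22 f) s r =
    (if r = a then N s a * x11 + N s b * x21 else if r = b then N s a * x12 + N s b * x22 else N s r * f r)"
proof -
  let ?M = "blockm a b x11 x12 x21 x22 f"
  have "(\<Sum>\<^sub>\<infinity>u. N s u * ?M u r) = N s a * ?M a r + N s b * ?M b r" if "r = a \<or> r = b"
    by (rule infsum_two[OF assms]) (use that in \<open>auto simp: blockm_def\<close>)
  moreover have "(\<Sum>\<^sub>\<infinity>u. N s u * ?M u r) = N s r * ?M r r" if "r \<noteq> a" "r \<noteq> b"
    by (rule infsum_one) (use that in \<open>auto simp: blockm_def\<close>)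
  ultimately show ?thesis using assms by (auto simp: mprod_def blockm_def)
qed

text \<open>The third claim, uniqueness of a right inverse among all infinite matrices, is what
  makes the description in \<open>mat_inv\<close> determinate.\<close>

lemma blockm_inverse:
  fixes a b :: "'a" and x11 x12 x21 x22 D :: complex and f :: "'a \<Rightarrow> complex"
  defines "M \<equiv> blockm a b x11 x12 x21 x22 f"
    and "X \<equiv> blockm a b (x22 / D) (- x12 / D) (- x21 / D) (x11 / D) (\<lambda>s. 1 / f s)"
  assumes ab: "a \<noteq> b" and D: "x11 * x22 - x12 * x21 = D" "D \<noteq> 0"
    and f: "\<And>s. s \<noteq> a \<Longrightarrow> s \<noteq> b \<Longrightarrow> f s \<noteq> 0"
  shows "mprod M X = (\<lambda>s r. if s = r then 1 else 0)"
    and "mprod X M = (\<lambda>s r. if s = r then 1 else 0)"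
    and "mprod M Y = (\<lambda>s r. if s = r then 1 else 0) \<Longrightarrow> Y = X"
proof -
  have D': "D + x12 * x21 = x11 * x22" using D(1) by (simp add: algebra_simps)
  show MX: "mprod M X = (\<lambda>s r. if s = r then 1 else 0)"
  proof (intro ext)
    fix s r
    have "x11 * (x22 / D) + x12 * (- x21 / D) = 1" "x11 * (- x12 / D) + x12 * (x11 / D) = 0"
      "x21 * (x22 / D) + x22 * (- x21 / D) = 0" "x21 * (- x12 / D) + x22 * (x11 / D) = 1"
      using D by (auto simp: field_simps)
    then show "mprod M X s r = (if s = r then 1 else 0)"
      unfolding M_def mprod_blockm_left[OF ab] using ab f by (simp add: X_def blockm_def)
  qed
  show "mprod X M = (\<lambda>s r. if s = r then 1 else 0)"
  proof (intro ext)
    fix s r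
    have "x22 / D * x11 + (- x12 / D) * x21 = 1" "x22 / D * x12 + (- x12 / D) * x22 = 0"
      "(- x21 / D) * x11 + x11 / D * x21 = 0" "(- x21 / D) * x12 + x11 / D * x22 = 1"
      using D by (auto simp: field_simps)
    then show "mprod X M s r = (if s = r then 1 else 0)"
      unfolding X_def mprod_blockm_left[OF ab] using ab f by (simp add: M_def blockm_def)
  qed
  assume MY: "mprod M Y = (\<lambda>s r. if s = r then 1 else 0)"
  show "Y = X"
  proof (intro ext)
    fix s r
    have eq: "mprod M Y u r = mprod M X u r" for u using MX MY by simp
    define x where "x = Y a r - X a r"
    define y where "y = Y b r - X b r"
    have 1: "x11 * x + x12 * y = 0"
      using eq[of a] unfolding M_def mprod_blockm_left[OF ab] x_def y_def by (simp add: algebra_simps)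
    have 2: "x21 * x + x22 * y = 0"
      using eq[of b] ab unfolding M_def mprod_blockm_left[OF ab] x_def y_def by (simp add: algebra_simps)
    \<comment> \<open>Cramer's rule: within one column the block components of \<open>Y - X\<close>
      solve a homogeneous system with determinant \<open>D\<close>.\<close>
    have "D * x = x22 * (x11 * x + x12 * y) - x12 * (x21 * x + x22 * y)"
      unfolding D(1)[symmetric] by (simp add: algebra_simps)
    then have "x = 0" unfolding 1 2 using D by simp
    have "D * y = x11 * (x21 * x + x22 * y) - x21 * (x11 * x + x12 * y)"
      unfolding D(1)[symmetric] by (simp add: algebra_simps)
    then have "y = 0" unfolding 1 2 using D by simp
    show "Y s r = X s r"
      using eq[of s] f[of s] \<open>x = 0\<close> \<open>y = 0\<close> ab unfolding M_def mprod_blockm_left[OF ab]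
      by (cases "s = a"; cases "s = b") (simp_all add: x_def y_def)
  qed
qed

lemma sum_le_delta:
  assumes "finite B" "\<And>s. s \<in> B \<Longrightarrow> 0 \<le> f s" "sum f B \<le> c"
  shows "sum_le (\<lambda>s. if s \<in> B then f s else 0) c"
proof (rule sum_leI)
  fix S :: "'a set" assume "finite S"
  then have "(\<Sum>s\<in>S. if s \<in> B then f s else 0) = sum f (S \<inter> B)" by (simp add: sum.inter_restrict)
  also have "\<dots> \<le> sum f B" using assms by (intro sum_mono2) auto
  finally show "(\<Sum>s\<in>S. if s \<in> B then f s else 0) \<le> c" using assms by simp
qed (use assms in auto)

section \<open>The model operator at a fixed quasimomentum\<close>

text \<open>One point \<open>t\<close> with its index and sign is fixed; the three circle conditions
  are those that \<open>resonant_set\<close> provides at such a point.\<close>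

locale resonant_model =
  fixes V :: "plane \<Rightarrow> complex" and R0 :: real and q j :: idx and t :: plane and sg \<epsilon> :: real
  assumes pot: "trig_potential R0 V" and q0: "q \<noteq> 0" and vq: "fourier V q \<noteq> 0"
    and eps: "0 < \<epsilon>" "\<epsilon> < 1 / 100000" and normV: "star_norm V < \<epsilon> ^ 9" and sg: "sg \<in> {1, - 1}"
    and circle_off: "\<And>z m. z \<in> sphere (complex_of_real (lam_hat V q sg j t)) (circ_radius \<epsilon>) \<Longrightarrow>
       m \<noteq> j \<Longrightarrow> m \<noteq> j - q \<Longrightarrow> \<epsilon> ^ 6 \<le> 2 * cmod (complex_of_real (psq m t) - z)"
    and circle_plus: "\<And>z. z \<in> sphere (complex_of_real (lam_hat V q sg j t)) (circ_radius \<epsilon>) \<Longrightarrow>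
       1 / 12 * \<epsilon> ^ 10 \<le> cmod (complex_of_real (lam_hat V q 1 j t) - z)"
    and circle_minus: "\<And>z. z \<in> sphere (complex_of_real (lam_hat V q sg j t)) (circ_radius \<epsilon>) \<Longrightarrow>
       1 / 12 * \<epsilon> ^ 10 \<le> cmod (complex_of_real (lam_hat V q (- 1) j t) - z)"
begin

abbreviation "B \<equiv> {j, j - q}"
abbreviation "lh \<equiv> lam_hat V q sg j t"
abbreviation "lp \<equiv> lam_hat V q 1 j t"
abbreviation "lm \<equiv> lam_hat V q (- 1) j t"
abbreviation "d \<equiv> circ_radius \<epsilon>"
abbreviation "\<alpha> \<equiv> psq j t"
abbreviation "\<beta> \<equiv> psq (j - q) t"
abbreviation "v \<equiv> fourier V q"

lemma jq: "j - q \<noteq> j" "j \<noteq> j - q" using q0 by auto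

lemma d_pos: "0 < d" using eps by (simp add: circ_radius_def)

text \<open>The square root in \<open>lam_hat\<close> dominates both the difference of the diagonal
  entries and twice the off-diagonal modulus. The resulting interlacing and gap control the
  numerators of the inverse block, and the Vieta relations factor its determinant.\<close>

lemma lam_hat_facts:
  shows "lm < lp" "lm \<le> \<alpha>" "\<alpha> \<le> lp" "lm \<le> \<beta>" "\<beta> \<le> lp" "2 * cmod v \<le> lp - lm"
    and lam_hat_vieta: "lp + lm = \<alpha> + \<beta>" "lp * lm = \<alpha> * \<beta> - (cmod v)\<^sup>2"
proof -
  define b where "b = sqrt (4 * (cmod v)\<^sup>2 + (\<alpha> - \<beta>)\<^sup>2)"
  have lp: "lp = (\<alpha> + \<beta>) / 2 + b / 2" and lm: "lm = (\<alpha> + \<beta>) / 2 - b / 2"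
    by (simp_all add: lam_hat_def b_def)
  have "\<bar>\<alpha> - \<beta>\<bar> \<le> b" unfolding b_def by (rule real_le_rsqrt) simp
  then have b1: "\<alpha> - \<beta> \<le> b" "\<beta> - \<alpha> \<le> b" by auto
  have b2: "2 * cmod v \<le> b" unfolding b_def by (rule real_le_rsqrt) (simp add: power_mult_distrib)
  have b3: "b\<^sup>2 = 4 * (cmod v)\<^sup>2 + (\<alpha> - \<beta>)\<^sup>2" unfolding b_def by simp
  have "0 < b" using b2 vq by (smt (verit) zero_less_norm_iff)
  then show "lm < lp" "lm \<le> \<alpha>" "\<alpha> \<le> lp" "lm \<le> \<beta>" "\<beta> \<le> lp" "2 * cmod v \<le> lp - lm" "lp + lm = \<alpha> + \<beta>"
    using b1 b2 unfolding lp lm by (auto simp: field_simps)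
  have "lp * lm = ((\<alpha> + \<beta>)\<^sup>2 - b\<^sup>2) / 4" unfolding lp lm by (simp add: power2_eq_square field_simps)
  also have "\<dots> = \<alpha> * \<beta> - (cmod v)\<^sup>2" unfolding b3 by (simp add: power2_eq_square field_simps)
  finally show "lp * lm = \<alpha> * \<beta> - (cmod v)\<^sup>2" .
qed

lemma lh_cases: "lh = lp \<or> lh = lm" using sg by auto

lemma lh_root: "(lh - \<alpha>) * (lh - \<beta>) = (cmod v)\<^sup>2"
proof -
  have "lp * (lp + lm) - lp * lm = lp * lp" "lm * (lp + lm) - lp * lm = lm * lm" by (simp_all add: algebra_simps)
  then have "lp * lp = lp * (\<alpha> + \<beta>) - (\<alpha> * \<beta> - (cmod v)\<^sup>2)" "lm * lm = lm * (\<alpha> + \<beta>) - (\<alpha> * \<beta> - (cmod v)\<^sup>2)"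
    unfolding lam_hat_vieta by simp_all
  then show ?thesis using lh_cases by (elim disjE) (simp_all add: algebra_simps)
qed

lemma block_det:
  "(of_real lp - z) * (of_real lm - z) = (of_real \<alpha> - z) * (of_real \<beta> - z) - v * cnj v"
proof -
  have "(of_real lp - z) * (of_real lm - z) = of_real (lp * lm) - of_real (lp + lm) * z + z * z"
    by (simp add: algebra_simps)
  also have "\<dots> = (of_real \<alpha> - z) * (of_real \<beta> - z) - of_real ((cmod v)\<^sup>2)"
    unfolding lam_hat_vieta by (simp add: algebra_simps)
  finally show ?thesis by (simp only: complex_norm_square)
qed

lemma circ_nonzero:
  assumes "z \<in> sphere (complex_of_real lh) d"
  shows "(of_real lp - z) * (of_real lm - z) \<noteq> 0" "m \<noteq> j \<Longrightarrow> m \<noteq> j - q \<Longrightarrow> of_real (psq m t) - z \<noteq> 0"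
proof -
  have "0 < 1 / 12 * \<epsilon> ^ 10" using eps by simp
  then show "(of_real lp - z) * (of_real lm - z) \<noteq> 0" using circle_plus[OF assms] circle_minus[OF assms] by fastforce
  show "of_real (psq m t) - z \<noteq> 0" if "m \<noteq> j" "m \<noteq> j - q"
    using circle_off[OF assms that] zero_less_power[OF eps(1), of 6] by (metis norm_zero mult_zero_right not_le)
qed

text \<open>Cramer's rule with the determinant factored through both eigenvalues as in
  \<open>block_det\<close>. This explicit formula replaces the description in
  \<open>mat_inv\<close>, so that continuity in \<open>z\<close> and entry bounds can be read
  off.\<close>

definition Rm :: "complex \<Rightarrow> cmat" where
  "Rm z = (let D = (of_real lp - z) * (of_real lm - z) in
    blockm j (j - q) ((of_real \<beta> - z) / D) (- v / D) (- cnj v / D) ((of_real \<alpha> - z) / D)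
      (\<lambda>s. 1 / (of_real (psq s t) - z)))"

lemma Hq_blockm:
  "(\<lambda>s r. Hq V q j t s r - z * mat_one s r) =
    blockm j (j - q) (of_real \<alpha> - z) v (cnj v) (of_real \<beta> - z) (\<lambda>s. of_real (psq s t) - z)"
  using jq trig_potential_0[OF pot] trig_potential_cnj[OF pot, of q]
  by (intro ext) (simp add: Hq_def H0_def PVP_def mult_mat_def blockm_def mat_one_def)

lemma resolvent_eq:
  assumes "z \<in> sphere (complex_of_real lh) d" shows "resolvent V q j t z = Rm z"
proof -
  have D: "(of_real \<alpha> - z) * (of_real \<beta> - z) - v * cnj v = (of_real lp - z) * (of_real lm - z)"
    by (simp add: block_det)
  note inv = blockm_inverse[OF jq(2) D circ_nonzero(1)[OF assms],
      of "\<lambda>s. of_real (psq s t) - z", OF circ_nonzero(2)[OF assms]]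
  show ?thesis
    unfolding resolvent_def mat_inv_def mat_mul_eq_mprod Hq_blockm
    unfolding mat_one_def Rm_def Let_def
    by (rule the_equality) (blast intro: inv(1,2) inv(3))+
qed

end

lemma sum_le_series:
  fixes g :: "nat \<Rightarrow> 'a \<Rightarrow> complex"
  assumes "\<And>n. sum_le (\<lambda>s. cmod (g n s)) (C * \<rho> ^ n)" "0 \<le> \<rho>" "\<rho> < 1"
  shows "summable (\<lambda>n. g n s)" and "sum_le (\<lambda>s. cmod (\<Sum>n. g n s)) (C / (1 - \<rho>))"
proof -
  have geo: "(\<lambda>n. C * \<rho> ^ n) sums (C / (1 - \<rho>))"
    using sums_mult[OF geometric_sums[of \<rho>], of C] assms(2,3) by simp
  have sn: "summable (\<lambda>n. cmod (g n s))" for s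
    by (rule summable_comparison_test'[OF sums_summable[OF geo]]) (use sum_le_point[OF assms(1)] in auto)
  then show "summable (\<lambda>n. g n s)" for s by (rule summable_norm_cancel)
  show "sum_le (\<lambda>s. cmod (\<Sum>n. g n s)) (C / (1 - \<rho>))"
  proof (rule sum_leI)
    fix S :: "'a set" assume S: "finite S"
    have "(\<Sum>s\<in>S. cmod (\<Sum>n. g n s)) \<le> (\<Sum>s\<in>S. \<Sum>n. cmod (g n s))"
      by (intro sum_mono summable_norm sn)
    also have "\<dots> = (\<Sum>n. \<Sum>s\<in>S. cmod (g n s))" by (rule suminf_sum[symmetric]) (rule sn)
    also have "\<dots> \<le> (\<Sum>n. C * \<rho> ^ n)"
      by (intro suminf_le summable_sum sn sums_summable[OF geo] sum_le_finite[OF assms(1) S])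
    finally show "(\<Sum>s\<in>S. cmod (\<Sum>n. g n s)) \<le> C / (1 - \<rho>)" using geo by (simp add: sums_iff)
  qed simp
qed

lemma regular_family_continuous:
  assumes "\<And>s. 1 \<le> om s" shows "regular_family Z (continuous_on Z) (om :: 'i \<Rightarrow> real)"
proof
  fix F :: "'i set \<Rightarrow> complex \<Rightarrow> complex" and g
  assume "\<And>S. continuous_on Z (F S)" "uniform_limit Z F g (finite_subsets_at_top UNIV)"
  then show "continuous_on Z g"
    by (intro uniform_limit_theorem[of _ F]) auto
qed (auto intro: assms continuous_intros)

lemma regular_family_holomorphic:
  assumes "\<And>s. 1 \<le> om s"
  shows "regular_family (cball c r) (\<lambda>f. continuous_on (cball c r) f \<and> f holomorphic_on ball c r) (om :: 'i \<Rightarrow> real)"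
proof
  fix F :: "'i set \<Rightarrow> complex \<Rightarrow> complex" and g
  assume "\<And>S. continuous_on (cball c r) (F S) \<and> F S holomorphic_on ball c r"
    and lim: "uniform_limit (cball c r) F g (finite_subsets_at_top UNIV)"
  then have "eventually (\<lambda>S. continuous_on (cball c r) (F S) \<and> F S holomorphic_on ball c r) (finite_subsets_at_top UNIV)"
    by simp
  then show "continuous_on (cball c r) g \<and> g holomorphic_on ball c r"
    using holomorphic_uniform_limit[OF _ lim] by auto
qed (auto intro: assms continuous_intros holomorphic_intros)

section \<open>Weighted estimates on the contour and in the disc\<close>

context resonant_model begin

definition om :: "idx \<Rightarrow> real" where
  "om s = (if s \<in> B then 1 else 1 / \<epsilon>\<^sup>2)"

lemma eps_powers: "0 < \<epsilon> ^ n" "\<epsilon> ^ n \<le> 1"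
  using eps by (auto intro: power_le_one)

lemma om_ge: "1 \<le> om s"
  using eps_powers[of 2] by (auto simp: om_def field_simps)

lemma om_B: "s \<in> B \<Longrightarrow> om s = 1" by (simp add: om_def)

sublocale sph: regular_family "sphere (complex_of_real lh) d" "continuous_on (sphere (complex_of_real lh) d)" om
  by (rule regular_family_continuous) (rule om_ge)

sublocale dsc: regular_family "cball (complex_of_real lh) d"
  "\<lambda>f. continuous_on (cball (complex_of_real lh) d) f \<and> f holomorphic_on ball (complex_of_real lh) d" om
  by (rule regular_family_holomorphic) (rule om_ge)

text \<open>Entrywise majorant of the resolvent times \<open>Y\<close>: \<open>y0\<close> dominates
  the entries of \<open>Y\<close> inside the block, \<open>y1\<close> all others, as functions of
  the index difference. The factors are the inverses of \<open>\<epsilon>^10 / 12\<close> (distance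
  to the eigenvalues) and \<open>\<epsilon>^6 / 4\<close> (distance to the other diagonal
  entries).\<close>

definition maj :: "(idx \<Rightarrow> real) \<Rightarrow> (idx \<Rightarrow> real) \<Rightarrow> idx \<Rightarrow> idx \<Rightarrow> real" where
  "maj y0 y1 s r = (if s \<in> B then 12 / \<epsilon> ^ 10 * (\<Sum>u\<in>B. if r \<in> B then y0 (u - r) else y1 (u - r))
     else 4 / \<epsilon> ^ 6 * y1 (s - r))"

lemma sum_le_shift:
  fixes r :: idx
  assumes "sum_le y c" shows "sum_le (\<lambda>u. y (u - r)) c"
proof -
  have "inj (\<lambda>u. u - r)" by (simp add: inj_def)
  from sum_le_comp_inj[OF assms this] show ?thesis .
qed

text \<open>Two block rows give \<open>24 / \<epsilon>^10\<close>, and the other rows with their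
  weight give \<open>4 / \<epsilon>^8\<close>. For a column outside the block one divides by its
  weight \<open>1 / \<epsilon>^2\<close>, so both parts are absorbed in
  \<open>28 / \<epsilon>^8 * \<delta>1\<close>, with \<open>28 = 24 + 4\<close>.\<close>

lemma colb_maj:
  assumes y0: "sum_le y0 \<delta>0" and y1: "sum_le y1 \<delta>1"
  shows "colb om (maj y0 y1) (24 / \<epsilon> ^ 10 * \<delta>0 + 28 / \<epsilon> ^ 8 * \<delta>1)"
  unfolding colb_def
proof
  fix r
  define T where "T = (\<Sum>u\<in>B. if r \<in> B then y0 (u - r) else y1 (u - r))"
  have n: "0 \<le> y0 m" "0 \<le> y1 m" for m using y0 y1 by (auto simp: sum_le_nonneg)
  have T0: "0 \<le> T" unfolding T_def by (intro sum_nonneg) (auto simp: n)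
  have T1: "T \<le> (if r \<in> B then \<delta>0 else \<delta>1)"
    unfolding T_def
    using sum_le_finite[OF sum_le_shift[OF y0], of B r] sum_le_finite[OF sum_le_shift[OF y1], of B r] by simp
  have dn: "0 \<le> \<delta>0" "0 \<le> \<delta>1" using y0 y1 by (auto intro: sum_le_bound_nonneg)
  have 1: "sum_le (\<lambda>s. if s \<in> B then 12 / \<epsilon> ^ 10 * T else 0) (24 / \<epsilon> ^ 10 * T)"
    by (rule sum_le_delta) (use jq T0 eps_powers in \<open>auto simp: field_simps\<close>)
  have 2: "sum_le (\<lambda>s. 4 / \<epsilon> ^ 8 * y1 (s - r)) (4 / \<epsilon> ^ 8 * \<delta>1)"
    by (rule sum_le_cmult[OF sum_le_shift[OF y1]]) (use eps_powers in auto)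
  show "sum_le (\<lambda>s. om s * maj y0 y1 s r) ((24 / \<epsilon> ^ 10 * \<delta>0 + 28 / \<epsilon> ^ 8 * \<delta>1) * om r)"
  proof (rule sum_le_mono[OF sum_le_add[OF 1 2]])
    fix s
    have e8: "\<epsilon> ^ 8 = \<epsilon>\<^sup>2 * \<epsilon> ^ 6" by (simp flip: power_add)
    have p: "0 \<le> 12 / \<epsilon> ^ 10 * T" "0 \<le> 4 / \<epsilon> ^ 6 * y1 (s - r)" "0 \<le> 4 / \<epsilon> ^ 8 * y1 (s - r)"
      using eps T0 n by auto
    show "0 \<le> om s * maj y0 y1 s r"
      using p sph.om_nonneg[of s] unfolding maj_def T_def[symmetric] by auto
    show "om s * maj y0 y1 s r \<le> (if s \<in> B then 12 / \<epsilon> ^ 10 * T else 0) + 4 / \<epsilon> ^ 8 * y1 (s - r)"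
      using p eps unfolding maj_def T_def[symmetric] om_def e8 by simp
  next
    have a: "4 / \<epsilon> ^ 8 * \<delta>1 \<le> 4 * (\<delta>1 / \<epsilon> ^ 10)"
      using eps dn divide_left_mono[OF power_decreasing[of 8 10 \<epsilon>], of \<delta>1] by simp
    have b: "24 / \<epsilon> ^ 10 * T \<le> 24 / \<epsilon> ^ 10 * (if r \<in> B then \<delta>0 else \<delta>1)"
      using T1 eps by (intro mult_left_mono) auto
    show "24 / \<epsilon> ^ 10 * T + 4 / \<epsilon> ^ 8 * \<delta>1 \<le> (24 / \<epsilon> ^ 10 * \<delta>0 + 28 / \<epsilon> ^ 8 * \<delta>1) * om r"
    proof (cases "r \<in> B")
      case True
      moreover have "4 / \<epsilon> ^ 8 * \<delta>1 \<le> 28 / \<epsilon> ^ 8 * \<delta>1"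
        using eps dn by (intro mult_right_mono divide_right_mono) auto
      ultimately show ?thesis using b om_B[OF True] by simp
    next
      case False
      have "28 * (\<delta>1 / \<epsilon> ^ 10) = 28 / \<epsilon> ^ 8 * \<delta>1 * (1 / \<epsilon>\<^sup>2)" by (simp flip: power_add)
      moreover have "0 \<le> 24 / \<epsilon> ^ 10 * \<delta>0 * (1 / \<epsilon>\<^sup>2)" using eps dn by simp
      moreover have "24 / \<epsilon> ^ 10 * T \<le> 24 * (\<delta>1 / \<epsilon> ^ 10)" using b False by simp
      moreover have "om r = 1 / \<epsilon>\<^sup>2" using False by (simp add: om_def)
      ultimately show ?thesis using a by (simp only: distrib_right)
    qed
  qed
qed

text \<open>Any point of the disc is within \<open>2 * d\<close> of one chosen point of the circle,
  and \<open>2 * d\<close> is at most half of the bound \<open>\<epsilon>^6 / 2\<close> known there.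
  The extension to the disc is what excludes poles of the off-block rows inside the contour.\<close>

lemma circ_dist_off:
  assumes "z \<in> cball (complex_of_real lh) d" "m \<noteq> j" "m \<noteq> j - q"
  shows "\<epsilon> ^ 6 / 4 \<le> cmod (of_real (psq m t) - z)"
proof -
  let ?w = "complex_of_real lh + of_real d"
  have w: "?w \<in> sphere (complex_of_real lh) d" using d_pos by (simp add: dist_norm)
  have "cmod (?w - z) \<le> 2 * d"
    using assms(1) norm_triangle_ineq[of "of_real d" "complex_of_real lh - z"] d_pos
    by (simp add: dist_norm algebra_simps)
  moreover have "2 * d \<le> \<epsilon> ^ 6 / 4"
  proof -
    have "\<epsilon> ^ 4 \<le> (1 / 100000) ^ 4" using eps by (intro power_mono) auto
    then have "\<epsilon> ^ 6 * \<epsilon> ^ 4 \<le> \<epsilon> ^ 6 * (1 / 4)" using eps by (intro mult_left_mono) (auto simp: power_divide)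
    then have "\<epsilon> ^ 10 \<le> \<epsilon> ^ 6 * (1 / 4)" by (simp flip: power_add)
    then show ?thesis unfolding circ_radius_def using eps_powers(1)[of 6] by linarith
  qed
  moreover have "\<epsilon> ^ 6 / 2 \<le> cmod (of_real (psq m t) - ?w)" using circle_off[OF w assms(2,3)] by simp
  moreover have "cmod (of_real (psq m t) - ?w) \<le> cmod (of_real (psq m t) - z) + cmod (?w - z)"
  proof -
    have "of_real (psq m t) - ?w = (of_real (psq m t) - z) - (?w - z)" by (simp add: algebra_simps)
    then show ?thesis using norm_triangle_ineq4[of "of_real (psq m t) - z" "?w - z"] by (simp only:)
  qed
  ultimately show ?thesis by linarith
qed

lemma block_quotient_bound:
  assumes z: "z \<in> sphere (complex_of_real lh) d"
    and e: "cmod e \<le> max (cmod (of_real lp - z)) (cmod (of_real lm - z))"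
  shows "cmod (e / ((of_real lp - z) * (of_real lm - z))) \<le> 12 / \<epsilon> ^ 10"
  using quotient_max_bound[of "\<epsilon> ^ 10 / 12" _ _ "cmod e", OF _ _ _ _ e] circle_plus[OF z] circle_minus[OF z] eps
  by (simp add: norm_divide norm_mult)

text \<open>Every numerator is at most the larger distance from \<open>z\<close> to the eigenvalues:
  for \<open>v\<close> because twice its modulus is at most the gap, for the diagonal entries by
  interlacing and convexity.\<close>

lemma Rm_bounds:
  assumes z: "z \<in> sphere (complex_of_real lh) d" and D: "D = (of_real lp - z) * (of_real lm - z)"
  shows "cmod ((of_real \<beta> - z) / D) \<le> 12 / \<epsilon> ^ 10" "cmod ((of_real \<alpha> - z) / D) \<le> 12 / \<epsilon> ^ 10"
    "cmod (- v / D) \<le> 12 / \<epsilon> ^ 10" "cmod (- cnj v / D) \<le> 12 / \<epsilon> ^ 10"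
proof -
  have "2 * cmod v \<le> cmod (of_real lp - of_real lm)"
    using lam_hat_facts(1,6) unfolding of_real_diff[symmetric] norm_of_real by simp
  also have "\<dots> \<le> cmod (of_real lp - z) + cmod (of_real lm - z)"
    using norm_triangle_ineq4[of "of_real lp - z" "of_real lm - z"] by simp
  finally have "cmod v \<le> max (cmod (of_real lp - z)) (cmod (of_real lm - z))" by linarith
  then show "cmod (- v / D) \<le> 12 / \<epsilon> ^ 10" "cmod (- cnj v / D) \<le> 12 / \<epsilon> ^ 10"
    unfolding D by (intro block_quotient_bound[OF z]; simp)+
  show "cmod ((of_real \<beta> - z) / D) \<le> 12 / \<epsilon> ^ 10" "cmod ((of_real \<alpha> - z) / D) \<le> 12 / \<epsilon> ^ 10"
    unfolding D
    using block_quotient_bound[OF z] convex_comb_norm_le[of lm _ lp z] lam_hat_facts by (simp_all add: max.commute)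
qed

lemma Rm_continuous: "continuous_on (sphere (complex_of_real lh) d) (\<lambda>z. Rm z s r)"
proof -
  let ?D = "\<lambda>z. (of_real lp - z) * (of_real lm - z)"
  note nz = circ_nonzero
  have 1: "continuous_on (sphere (complex_of_real lh) d) (\<lambda>z. e z / ?D z)"
    if "continuous_on (sphere (complex_of_real lh) d) e" for e
    by (rule continuous_on_divide[OF that]) (use nz(1) in \<open>auto intro!: continuous_intros\<close>)
  have 2: "continuous_on (sphere (complex_of_real lh) d) (\<lambda>z. 1 / (of_real (psq s t) - z))" if "s \<noteq> j" "s \<noteq> j - q" for s
    by (rule continuous_on_divide) (use nz(2)[OF _ that] in \<open>auto intro!: continuous_intros\<close>)
  show ?thesis
    unfolding Rm_def Let_def blockm_def
    by (cases "s = j"; cases "s = j - q"; cases "r = j"; cases "r = j - q"; cases "s = r")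
      (use jq in \<open>simp_all add: 2\<close>, auto intro!: 1 2 continuous_intros)
qed

lemma sph_fam_Rm_mul:
  assumes y0: "sum_le y0 \<delta>0" and y1: "sum_le y1 \<delta>1"
    and Y: "\<And>s r. cmod (Y s r) \<le> (if s \<in> B \<and> r \<in> B then y0 (s - r) else y1 (s - r))"
  shows "sph.fam (\<lambda>z. mprod (Rm z) Y) (24 / \<epsilon> ^ 10 * \<delta>0 + 28 / \<epsilon> ^ 8 * \<delta>1)"
proof (rule sph.famI[OF _ _ colb_maj[OF y0 y1]])
  have eq: "mprod (Rm z) Y s r = (if s = j then Rm z j j * Y j r + Rm z j (j - q) * Y (j - q) r
      else if s = j - q then Rm z (j - q) j * Y j r + Rm z (j - q) (j - q) * Y (j - q) r
      else Rm z s s * Y s r)" for z s r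
    unfolding Rm_def Let_def mprod_blockm_left[OF jq(2)] using jq by (simp add: blockm_def)
  show "continuous_on (sphere (complex_of_real lh) d) (\<lambda>z. mprod (Rm z) Y s r)" for s r
    unfolding eq by (cases "s = j"; cases "s = j - q") (use jq in \<open>auto intro!: continuous_intros Rm_continuous\<close>)
  fix z s r assume z: "z \<in> sphere (complex_of_real lh) d"
  let ?T = "\<lambda>u. if r \<in> B then y0 (u - r) else y1 (u - r)"
  have Yb: "cmod (Y u r) \<le> ?T u" if "u \<in> B" for u using Y[of u r] that by auto
  have blk: "cmod (a * Y j r + b * Y (j - q) r) \<le> 12 / \<epsilon> ^ 10 * (\<Sum>u\<in>B. ?T u)"
    if "cmod a \<le> 12 / \<epsilon> ^ 10" "cmod b \<le> 12 / \<epsilon> ^ 10" for a b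
  proof -
    have "cmod (a * Y j r + b * Y (j - q) r) \<le> cmod a * cmod (Y j r) + cmod b * cmod (Y (j - q) r)"
      using norm_triangle_ineq by (metis norm_mult)
    also have "\<dots> \<le> 12 / \<epsilon> ^ 10 * ?T j + 12 / \<epsilon> ^ 10 * ?T (j - q)"
      using that eps by (intro add_mono mult_mono Yb) auto
    also have "\<dots> = 12 / \<epsilon> ^ 10 * (\<Sum>u\<in>B. ?T u)" using jq by (simp add: distrib_left)
    finally show ?thesis .
  qed
  show "cmod (mprod (Rm z) Y s r) \<le> maj y0 y1 s r"
  proof (cases "s \<in> B")
    case True
    note rb = Rm_bounds[OF z refl]
    from True have "s = j \<or> s \<noteq> j \<and> s = j - q" by blast
    then show ?thesis
    proof (elim disjE conjE)
      assume 1: "s = j"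
      show ?thesis unfolding maj_def if_P[OF True] Rm_def Let_def mprod_blockm_left[OF jq(2)] if_P[OF 1]
        by (rule blk[OF rb(1,3)])
    next
      assume 2: "s \<noteq> j" "s = j - q"
      show ?thesis
        unfolding maj_def if_P[OF True] Rm_def Let_def mprod_blockm_left[OF jq(2)] if_not_P[OF 2(1)] if_P[OF 2(2)]
        by (rule blk[OF rb(4,2)])
    qed
  next
    case False
    then have sB: "s \<noteq> j" "s \<noteq> j - q" by auto
    have "\<epsilon> ^ 6 / 4 \<le> cmod (of_real (psq s t) - z)"
      by (rule circ_dist_off) (use z sB in auto)
    then have "1 / cmod (of_real (psq s t) - z) \<le> 1 / (\<epsilon> ^ 6 / 4)"
      using eps_powers(1)[of 6] by (intro divide_left_mono mult_pos_pos) auto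
    then have "cmod (1 / (of_real (psq s t) - z) * Y s r) \<le> 4 / \<epsilon> ^ 6 * y1 (s - r)"
      unfolding norm_mult norm_divide using Y[of s r] sB by (intro mult_mono) auto
    then show ?thesis
      unfolding Rm_def Let_def mprod_blockm_left[OF jq(2)] maj_def using sB by simp
  qed
qed

text \<open>The rows of resolvent times \<open>Y\<close> outside the block; these have no pole inside the contour.\<close>

definition Lm :: "cmat \<Rightarrow> complex \<Rightarrow> cmat" where
  "Lm Y z s r = (if s \<in> B then 0 else Y s r / (of_real (psq s t) - z))"

text \<open>The disc version feeds Cauchy's theorem; the circle version allows comparison with the
  full matrix, which is controlled only on the circle. Deleting rows leaves the majorant
  \<open>maj\<close> valid.\<close>

lemma
  assumes y0: "sum_le y0 \<delta>0" and y1: "sum_le y1 \<delta>1"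
    and Y: "\<And>s r. cmod (Y s r) \<le> (if s \<in> B \<and> r \<in> B then y0 (s - r) else y1 (s - r))"
  shows dsc_fam_Lm: "dsc.fam (Lm Y) (24 / \<epsilon> ^ 10 * \<delta>0 + 28 / \<epsilon> ^ 8 * \<delta>1)"
    and sph_fam_Lm: "sph.fam (Lm Y) (24 / \<epsilon> ^ 10 * \<delta>0 + 28 / \<epsilon> ^ 8 * \<delta>1)"
proof -
  have bound: "cmod (Lm Y z s r) \<le> maj y0 y1 s r" if z: "z \<in> cball (complex_of_real lh) d" for z s r
  proof (cases "s \<in> B")
    case True
    have "0 \<le> (\<Sum>u\<in>B. if r \<in> B then y0 (u - r) else y1 (u - r))"
      by (intro sum_nonneg) (use y0 y1 in \<open>auto simp: sum_le_nonneg\<close>)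
    with True eps show ?thesis unfolding Lm_def maj_def by simp
  next
    case False
    then have sB: "s \<noteq> j" "s \<noteq> j - q" by auto
    have "\<epsilon> ^ 6 / 4 \<le> cmod (of_real (psq s t) - z)"
      by (rule circ_dist_off) (use z sB in auto)
    then have "1 / cmod (of_real (psq s t) - z) \<le> 1 / (\<epsilon> ^ 6 / 4)"
      using eps_powers(1)[of 6] by (intro divide_left_mono mult_pos_pos) auto
    then have "cmod (1 / (of_real (psq s t) - z) * Y s r) \<le> 4 / \<epsilon> ^ 6 * y1 (s - r)"
      unfolding norm_mult norm_divide using Y[of s r] sB by (intro mult_mono) auto
    then show ?thesis unfolding Lm_def maj_def using sB by simp
  qed
  have nz: "of_real (psq s t) - z \<noteq> 0" if "z \<in> cball (complex_of_real lh) d" "s \<notin> B" for z s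
    using circ_dist_off[OF that(1), of s] that(2) eps_powers(1)[of 6] by auto
  have cont: "continuous_on (cball (complex_of_real lh) d) (\<lambda>z. Lm Y z s r)" for s r
    unfolding Lm_def by (cases "s \<in> B") (use nz[of _ s] in \<open>simp_all del: insert_iff, auto intro!: continuous_intros\<close>)
  have hol: "(\<lambda>z. Lm Y z s r) holomorphic_on ball (complex_of_real lh) d" for s r
    unfolding Lm_def by (cases "s \<in> B") (use nz[of _ s] in \<open>simp_all del: insert_iff, auto intro!: holomorphic_intros\<close>)
  show "dsc.fam (Lm Y) (24 / \<epsilon> ^ 10 * \<delta>0 + 28 / \<epsilon> ^ 8 * \<delta>1)"
    by (rule dsc.famI[OF conjI[OF cont hol] bound colb_maj[OF y0 y1]])
  show "sph.fam (Lm Y) (24 / \<epsilon> ^ 10 * \<delta>0 + 28 / \<epsilon> ^ 8 * \<delta>1)"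
    by (rule sph.famI[OF continuous_on_subset[OF cont] bound colb_maj[OF y0 y1]]) auto
qed

lemma sph_fam_Rm: "sph.fam Rm (24 / \<epsilon> ^ 10)"
proof (rule sph.famI[OF Rm_continuous, where m = "\<lambda>s r. if s \<in> B then if r \<in> B then 12 / \<epsilon> ^ 10 else 0 else if s = r then 4 / \<epsilon> ^ 6 else 0"])
  fix z s r assume z: "z \<in> sphere (complex_of_real lh) d"
  have "1 / cmod (of_real (psq s t) - z) \<le> 1 / (\<epsilon> ^ 6 / 4)" if "s \<notin> B"
    using circ_dist_off[of z s] that z eps_powers(1)[of 6] by (intro divide_left_mono mult_pos_pos) auto
  then show "cmod (Rm z s r) \<le> (if s \<in> B then if r \<in> B then 12 / \<epsilon> ^ 10 else 0 else if s = r then 4 / \<epsilon> ^ 6 else 0)"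
    unfolding Rm_def Let_def blockm_def using Rm_bounds[OF z refl] jq by (auto simp: norm_divide)
next
  show "colb om (\<lambda>s r. if s \<in> B then if r \<in> B then 12 / \<epsilon> ^ 10 else 0 else if s = r then 4 / \<epsilon> ^ 6 else 0) (24 / \<epsilon> ^ 10)"
    unfolding colb_def
  proof
    fix r
    show "sum_le (\<lambda>s. om s * (if s \<in> B then if r \<in> B then 12 / \<epsilon> ^ 10 else 0 else if s = r then 4 / \<epsilon> ^ 6 else 0)) (24 / \<epsilon> ^ 10 * om r)"
    proof (cases "r \<in> B")
      case True
      have "sum_le (\<lambda>s. if s \<in> B then 12 / \<epsilon> ^ 10 else 0) (24 / \<epsilon> ^ 10)"
        by (rule sum_le_delta) (use jq eps in auto)
      moreover have "(\<lambda>s. om s * (if s \<in> B then if r \<in> B then 12 / \<epsilon> ^ 10 else 0 else if s = r then 4 / \<epsilon> ^ 6 else 0))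
         = (\<lambda>s. if s \<in> B then 12 / \<epsilon> ^ 10 else 0)" using True by (intro ext) (auto simp: om_B)
      ultimately show ?thesis using om_B[OF True] by simp
    next
      case False
      have "4 / \<epsilon> ^ 6 \<le> 24 / \<epsilon> ^ 10"
        using eps eps_powers(1)[of 6] power_decreasing[of 6 10 \<epsilon>] by (intro frac_le) auto
      then have "sum_le (\<lambda>s. if s \<in> {r} then om r * (4 / \<epsilon> ^ 6) else 0) (24 / \<epsilon> ^ 10 * om r)"
        using mult_right_mono[OF _ sph.om_nonneg[of r], of "4 / \<epsilon> ^ 6" "24 / \<epsilon> ^ 10"] eps sph.om_nonneg[of r]
        by (intro sum_le_delta) (auto simp: mult.commute)
      moreover have "(\<lambda>s. om s * (if s \<in> B then if r \<in> B then 12 / \<epsilon> ^ 10 else 0 else if s = r then 4 / \<epsilon> ^ 6 else 0))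
         = (\<lambda>s. if s \<in> {r} then om r * (4 / \<epsilon> ^ 6) else 0)" using False by (intro ext) auto
      ultimately show ?thesis by simp
    qed
  qed
qed

end

subsection \<open>Perturbation series\<close>

lemma mprod_blockm_diff:
  assumes "a \<noteq> b"
  shows "mprod (\<lambda>s r. M s r - N s r) (blockm a b x11 x12 x21 x22 f) s r =
      mprod M (blockm a b x11 x12 x21 x22 f) s r - mprod N (blockm a b x11 x12 x21 x22 f) s r"
    and "mprod (blockm a b x11 x12 x21 x22 f) (\<lambda>s r. M s r - N s r) s r =
      mprod (blockm a b x11 x12 x21 x22 f) M s r - mprod (blockm a b x11 x12 x21 x22 f) N s r"
  by (simp_all add: mprod_blockm_left[OF assms] mprod_blockm_right[OF assms] algebra_simps)

context resonant_model begin

abbreviation "\<kappa> \<equiv> 2500 * \<epsilon>"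

text \<open>Expressed through coefficients instead of functions, so that the difference of two such
  matrices depends only on the difference of the potentials: \<open>V\<close> cancels.\<close>

definition Ymat :: "(idx \<Rightarrow> complex) \<Rightarrow> cmat" where
  "Ymat w s r = (if s \<in> B \<and> r \<in> B then w (s - r) - fourier V (s - r) else w (s - r))"

lemma mult_mat_minus_PVP: "(\<lambda>s r. mult_mat W s r - PVP V q j s r) = Ymat (fourier W)"
  by (simp add: fun_eq_iff Ymat_def mult_mat_def PVP_def)

text \<open>The ball around \<open>V\<close> in which the iteration stays; one step moves at most
  \<open>36 * \<epsilon>^11\<close> away from \<open>V\<close>, so the radius leaves room.\<close>

definition good :: "(idx \<Rightarrow> complex) \<Rightarrow> bool" where
  "good w \<longleftrightarrow> sum_le (\<lambda>m. cmod (w m - fourier V m)) (100 * \<epsilon> ^ 11)"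

lemma V_sum_le: "sum_le (\<lambda>m. cmod (fourier V m)) (\<epsilon> ^ 9)"
  by (rule sum_le_mono[OF star_space_sum_le[OF trig_potential_star[OF pot]]]) (use normV in auto)

lemma good_sum_le:
  assumes "good w" shows "sum_le (\<lambda>m. cmod (w m)) (2 * \<epsilon> ^ 9)"
proof (rule sum_le_mono[OF sum_le_add[OF assms[unfolded good_def] V_sum_le]])
  show "cmod (w m) \<le> cmod (w m - fourier V m) + cmod (fourier V m)" for m
    using norm_triangle_ineq[of "w m - fourier V m" "fourier V m"] by simp
  have "\<epsilon>\<^sup>2 \<le> (1 / 100000)\<^sup>2" using eps by (intro power_mono) auto
  then have "\<epsilon>\<^sup>2 * \<epsilon> ^ 9 \<le> (1 / 100) * \<epsilon> ^ 9" using eps by (intro mult_right_mono) (auto simp: power_divide)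
  then show "100 * \<epsilon> ^ 11 + \<epsilon> ^ 9 \<le> 2 * \<epsilon> ^ 9" by (simp flip: power_add)
qed simp

lemma good_V: "good (fourier V)"
  using eps by (simp add: good_def sum_le_def)

lemma Ymat_bound:
  "cmod (Ymat w s r) \<le> (if s \<in> B \<and> r \<in> B then cmod (w (s - r) - fourier V (s - r)) else cmod (w (s - r)))"
  by (simp add: Ymat_def)

lemma \<kappa>_bounds: "0 < \<kappa>" "\<kappa> \<le> 1 / 4"
  using eps by auto

text \<open>The constants add up to \<open>24 * 100 + 28 * 2 = 2456\<close>, rounded up in
  \<open>\<kappa>\<close>.\<close>

lemma kappa_bound: "24 / \<epsilon> ^ 10 * (100 * \<epsilon> ^ 11) + 28 / \<epsilon> ^ 8 * (2 * \<epsilon> ^ 9) \<le> \<kappa>"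
proof -
  have "\<epsilon> ^ 11 = \<epsilon> ^ 10 * \<epsilon>" "\<epsilon> ^ 9 = \<epsilon> ^ 8 * \<epsilon>" by (simp_all flip: power_Suc2)
  then show ?thesis using eps by simp
qed

definition K :: "(idx \<Rightarrow> complex) \<Rightarrow> complex \<Rightarrow> cmat" where
  "K w z = mprod (Rm z) (Ymat w)"

lemma K_fam: "good w \<Longrightarrow> sph.fam (K w) \<kappa>"
  unfolding K_def[abs_def] good_def
  by (rule sph.fam_mono[OF sph_fam_Rm_mul[OF _ good_sum_le Ymat_bound[of w]] kappa_bound]) (auto simp: good_def)

lemma L_fam:
  assumes "good w" shows "sph.fam (Lm (Ymat w)) \<kappa>" "dsc.fam (Lm (Ymat w)) \<kappa>"
  using sph.fam_mono[OF sph_fam_Lm[OF _ good_sum_le Ymat_bound[of w]] kappa_bound]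
    dsc.fam_mono[OF dsc_fam_Lm[OF _ good_sum_le Ymat_bound[of w]] kappa_bound] assms
  by (auto simp: good_def)

text \<open>Differences of two potentials gain nothing inside the block, so \<open>\<delta>\<close>
  bounds all entries alike and \<open>52 = 24 + 28\<close>. The loss of \<open>\<epsilon>^10\<close>
  is later repaid by the coupling of order \<open>\<epsilon>^11\<close>.\<close>

lemma K_diff_fam:
  assumes w: "good w" "good w'" and \<delta>: "sum_le (\<lambda>m. cmod (w m - w' m)) \<delta>"
  shows "sph.fam (\<lambda>z s r. K w z s r - K w' z s r) (52 / \<epsilon> ^ 10 * \<delta>)"
proof -
  have "28 / \<epsilon> ^ 8 \<le> 28 / \<epsilon> ^ 10" using eps by (intro divide_left_mono power_decreasing) auto
  from mult_right_mono[OF this sum_le_bound_nonneg[OF \<delta>]]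
  have le: "24 / \<epsilon> ^ 10 * \<delta> + 28 / \<epsilon> ^ 8 * \<delta> \<le> 52 / \<epsilon> ^ 10 * \<delta>"
    by simp
  have "K w z s r - K w' z s r = mprod (Rm z) (\<lambda>s r. w (s - r) - w' (s - r)) s r" for z s r
  proof -
    have "(\<lambda>s r. w (s - r) - w' (s - r)) = (\<lambda>s r. Ymat w s r - Ymat w' s r)"
      by (simp add: fun_eq_iff Ymat_def)
    then show ?thesis unfolding K_def Rm_def Let_def by (simp only: mprod_blockm_diff(2)[OF jq(2)])
  qed
  moreover have "sph.fam (\<lambda>z. mprod (Rm z) (\<lambda>s r. w (s - r) - w' (s - r))) (52 / \<epsilon> ^ 10 * \<delta>)"
    by (rule sph.fam_mono[OF sph_fam_Rm_mul[OF \<delta> \<delta>] le]) simp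
  ultimately show ?thesis by simp
qed

definition CI :: "(complex \<Rightarrow> complex) \<Rightarrow> complex" where
  "CI f = contour_integral (circlepath (complex_of_real lh) d) f"

lemma path_image_circ: "path_image (circlepath (complex_of_real lh) d) = sphere (complex_of_real lh) d"
  using d_pos by simp

lemma CI_cong: "(\<And>z. z \<in> sphere (complex_of_real lh) d \<Longrightarrow> f z = g z) \<Longrightarrow> CI f = CI g"
  unfolding CI_def by (rule contour_integral_eq) (simp only: path_image_circ)

lemma integrable_circ:
  "continuous_on (sphere (complex_of_real lh) d) f \<Longrightarrow> f contour_integrable_on circlepath (complex_of_real lh) d"
  by (rule contour_integrable_continuous_circlepath) (simp only: path_image_circ)

lemma CI_diff:
  assumes "continuous_on (sphere (complex_of_real lh) d) f" "continuous_on (sphere (complex_of_real lh) d) g"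
  shows "CI (\<lambda>z. f z - g z) = CI f - CI g"
  unfolding CI_def by (rule contour_integral_diff) (use assms integrable_circ in auto)

lemma CI_bound:
  assumes "continuous_on (sphere (complex_of_real lh) d) f" "\<And>z. z \<in> sphere (complex_of_real lh) d \<Longrightarrow> cmod (f z) \<le> b"
  shows "cmod (CI f) \<le> (2 * pi * d) * b"
proof -
  have "complex_of_real lh + of_real d \<in> sphere (complex_of_real lh) d" using d_pos by (simp add: dist_norm)
  then have "0 \<le> b" using assms(2) norm_ge_zero order_trans by blast
  have "cmod (CI f) \<le> b * (2 * pi * d)"
    unfolding CI_def
    by (rule has_contour_integral_bound_circlepath[OF has_contour_integral_integral[OF integrable_circ[OF assms(1)]] \<open>0 \<le> b\<close> d_pos])
      (use assms(2) in \<open>auto simp: dist_norm norm_minus_commute\<close>)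
  then show ?thesis by (simp add: mult_ac)
qed

lemma CI_fam:
  assumes "sph.fam M c" shows "sum_le (\<lambda>s. cmod (CI (\<lambda>z. M z s r))) (2 * pi * d * c * om r)"
proof -
  obtain m where m: "\<forall>z\<in>sphere (complex_of_real lh) d. \<forall>s r. cmod (M z s r) \<le> m s r" and col: "colb om m c"
    using assms unfolding sph.fam_def by blast
  have pd: "0 \<le> 2 * pi * d" using d_pos by simp
  have "sum_le (\<lambda>s. 2 * pi * d * (om s * m s r)) (2 * pi * d * (c * om r))"
    by (rule sum_le_cmult[OF spec[OF col[unfolded colb_def]] pd])
  then show ?thesis
  proof (rule sum_le_mono)
    fix s
    have "cmod (CI (\<lambda>z. M z s r)) \<le> (2 * pi * d) * m s r"
      by (rule CI_bound[OF sph.fam_Q[OF assms]]) (use m in blast)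
    also have "\<dots> \<le> 2 * pi * d * (om s * m s r)"
      using colb_point(1)[OF col om_ge, of s r] mult_right_mono[OF om_ge, of "m s r" s] by (intro mult_left_mono pd) auto
    finally show "cmod (CI (\<lambda>z. M z s r)) \<le> 2 * pi * d * (om s * m s r)" .
  qed (auto simp: mult_ac)
qed

lemma CI_nfam:
  assumes "sph.nfam M c" shows "sum_le (\<lambda>s. cmod (CI (\<lambda>z. M z s s))) (2 * pi * d * c)"
proof -
  obtain m where m: "\<forall>z\<in>sphere (complex_of_real lh) d. \<forall>s r. cmod (M z s r) \<le> m s * om r"
    and c: "sum_le (\<lambda>s. om s * m s) c"
    using assms unfolding sph.nfam_def by blast
  have pd: "0 \<le> 2 * pi * d" using d_pos by simp
  show ?thesis
  proof (rule sum_le_mono[OF sum_le_cmult[OF c pd]])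
    fix s
    show "cmod (CI (\<lambda>z. M z s s)) \<le> 2 * pi * d * (om s * m s)"
      unfolding mult.commute[of "om s"] by (rule CI_bound[OF sph.nfam_Q[OF assms]]) (use m in blast)
  qed auto
qed

lemma RY_eq:
  assumes "z \<in> sphere (complex_of_real lh) d" shows "RY V q j t W z = K (fourier W) z"
  unfolding RY_def mult_mat_minus_PVP mat_mul_eq_mprod K_def resolvent_eq[OF assms] ..

definition F :: "(idx \<Rightarrow> complex) \<Rightarrow> nat \<Rightarrow> complex \<Rightarrow> cmat" where
  "F w n z = mprod (mpow (K w z) n) (Rm z)"

lemma G_hat_eq:
  "G_hat V q \<epsilon> sg j t W n s s' = (- 1) ^ (n + 1) / (2 * complex_of_real pi * \<i>) * CI (\<lambda>z. F (fourier W) n z s s')"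
proof -
  have "CI (\<lambda>z. mat_mul (mat_pow (RY V q j t W z) n) (resolvent V q j t z) s s') = CI (\<lambda>z. F (fourier W) n z s s')"
    by (rule CI_cong) (simp add: RY_eq resolvent_eq mat_mul_eq_mprod mat_pow_eq_mpow F_def)
  then show ?thesis by (simp add: G_hat_def circ_def CI_def)
qed

lemma F_fam: "good w \<Longrightarrow> sph.fam (F w n) (\<kappa> ^ n * (24 / \<epsilon> ^ 10))"
  unfolding F_def[abs_def] by (rule sph.fam_mul[OF sph.fam_pow[OF K_fam] sph_fam_Rm])

lemma F_diff_fam:
  assumes w: "good w" "good w'" and \<delta>: "sum_le (\<lambda>m. cmod (w m - w' m)) \<delta>"
  shows "sph.fam (\<lambda>z s r. F w n z s r - F w' n z s r) (real n * \<kappa> ^ (n - 1) * (52 / \<epsilon> ^ 10 * \<delta>) * (24 / \<epsilon> ^ 10))"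
proof -
  note Kw = K_fam[OF w(1)] K_fam[OF w(2)]
  have "sph.fam (\<lambda>z. mprod (\<lambda>s r. mpow (K w z) n s r - mpow (K w' z) n s r) (Rm z))
      (real n * \<kappa> ^ (n - 1) * (52 / \<epsilon> ^ 10 * \<delta>) * (24 / \<epsilon> ^ 10))"
    by (rule sph.fam_mul[OF sph.fam_pow_diff[OF Kw K_diff_fam[OF w \<delta>]] sph_fam_Rm])
  moreover have "(\<lambda>z. mprod (\<lambda>s r. mpow (K w z) n s r - mpow (K w' z) n s r) (Rm z)) = (\<lambda>z s r. F w n z s r - F w' n z s r)"
    unfolding F_def Rm_def Let_def by (intro ext) (rule mprod_blockm_diff(1)[OF jq(2)])
  ultimately show ?thesis by (simp only:)
qed

text \<open>The contour has length of order \<open>\<epsilon>^10\<close>, which cancels the bound of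
  the last resolvent; \<open>8\<close> is \<open>24 / 3\<close>.\<close>

lemma d_cancel: "2 * pi * d * (x * (24 / \<epsilon> ^ 10)) = 2 * pi * (8 * x)"
  using eps by (simp add: circ_radius_def)

lemma kappa_pow: "\<kappa> ^ n \<le> (1 / 4) ^ n"
  using \<kappa>_bounds by (intro power_mono) auto

lemma kappa_pow_half: "\<kappa> ^ n \<le> (1 / 2) ^ n"
  using \<kappa>_bounds by (intro power_mono) auto

text \<open>Half of the decay \<open>4^-n\<close> is spent on \<open>n + 1 \<le> 2^n\<close>, the
  factor produced by differences of powers; this is why \<open>\<kappa>\<close> is kept below
  \<open>1 / 4\<close>.\<close>

lemma kappa_pow_n: "real (Suc n) * \<kappa> ^ n \<le> (1 / 2) ^ n"
proof -
  have "real (Suc n) \<le> 2 ^ n"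
    using of_nat_mono[OF Suc_leI[OF less_exp[of n]], where 'a = real] by simp
  then have "real (Suc n) * \<kappa> ^ n \<le> 2 ^ n * (1 / 4) ^ n"
    using kappa_pow[of n] \<kappa>_bounds by (intro mult_mono) auto
  also have "\<dots> = (1 / 2) ^ n" by (simp flip: power_mult_distrib)
  finally show ?thesis .
qed

lemma norm_prefactor: "cmod ((- 1) ^ n / (2 * complex_of_real pi * \<i>) * x) = cmod x / (2 * pi)"
  by (simp add: norm_mult norm_divide norm_power)

lemma G_bound:
  assumes "good (fourier W)"
  shows "sum_le (\<lambda>s. cmod (G_hat V q \<epsilon> sg j t W (Suc n) s j)) (2 * (1 / 2) ^ n)"
proof -
  have "sum_le (\<lambda>s. 1 / (2 * pi) * cmod (CI (\<lambda>z. F (fourier W) (Suc n) z s j)))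
      (1 / (2 * pi) * (2 * pi * d * (\<kappa> ^ Suc n * (24 / \<epsilon> ^ 10)) * om j))"
    by (rule sum_le_cmult[OF CI_fam[OF F_fam[OF assms]]]) simp
  then show ?thesis
  proof (rule sum_le_mono)
    have "8 * \<kappa> ^ Suc n \<le> 8 * ((1 / 4) * (1 / 2) ^ n)"
      unfolding power_Suc using \<kappa>_bounds kappa_pow_half by (intro mult_left_mono mult_mono) auto
    then show "1 / (2 * pi) * (2 * pi * d * (\<kappa> ^ Suc n * (24 / \<epsilon> ^ 10)) * om j) \<le> 2 * (1 / 2) ^ n"
      unfolding d_cancel by (simp add: om_B)
  qed (simp_all only: G_hat_eq norm_prefactor, simp_all)
qed

lemma G_diff:
  assumes w: "good (fourier W)" "good (fourier W')" and \<delta>: "sum_le (\<lambda>m. cmod (fourier W m - fourier W' m)) \<delta>"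
  shows "sum_le (\<lambda>s. cmod (G_hat V q \<epsilon> sg j t W (Suc n) s j - G_hat V q \<epsilon> sg j t W' (Suc n) s j))
    (416 / \<epsilon> ^ 10 * \<delta> * (1 / 2) ^ n)"
proof -
  let ?D = "\<lambda>z s r. F (fourier W) (Suc n) z s r - F (fourier W') (Suc n) z s r"
  have dn: "0 \<le> \<delta>" by (rule sum_le_bound_nonneg[OF \<delta>])
  have "sum_le (\<lambda>s. 1 / (2 * pi) * cmod (CI (\<lambda>z. ?D z s j)))
      (1 / (2 * pi) * (2 * pi * d * (real (Suc n) * \<kappa> ^ n * (52 / \<epsilon> ^ 10 * \<delta>) * (24 / \<epsilon> ^ 10)) * om j))"
    using sum_le_cmult[OF CI_fam[OF F_diff_fam[OF w \<delta>, of "Suc n"]], of "1 / (2 * pi)" j] by simp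
  then show ?thesis
  proof (rule sum_le_mono)
    have "8 * (real (Suc n) * \<kappa> ^ n * (52 / \<epsilon> ^ 10 * \<delta>)) \<le> 8 * ((1 / 2) ^ n * (52 / \<epsilon> ^ 10 * \<delta>))"
      using kappa_pow_n[of n] dn eps by (intro mult_left_mono mult_right_mono) auto
    then show "1 / (2 * pi) * (2 * pi * d * (real (Suc n) * \<kappa> ^ n * (52 / \<epsilon> ^ 10 * \<delta>) * (24 / \<epsilon> ^ 10)) * om j)
        \<le> 416 / \<epsilon> ^ 10 * \<delta> * (1 / 2) ^ n"
      unfolding d_cancel by (simp add: om_B mult_ac)
    fix s
    have "CI (\<lambda>z. ?D z s j) = CI (\<lambda>z. F (fourier W) (Suc n) z s j) - CI (\<lambda>z. F (fourier W') (Suc n) z s j)"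
      by (rule CI_diff) (rule sph.fam_Q[OF F_fam[OF w(1)]] sph.fam_Q[OF F_fam[OF w(2)]])+
    then show "cmod (G_hat V q \<epsilon> sg j t W (Suc n) s j - G_hat V q \<epsilon> sg j t W' (Suc n) s j)
        \<le> 1 / (2 * pi) * cmod (CI (\<lambda>z. ?D z s j))"
      unfolding G_hat_eq right_diff_distrib[symmetric] norm_prefactor by simp
  qed simp
qed

section \<open>The projection and its dependence on the potential\<close>

text \<open>As \<open>v\<close> is nonzero, row \<open>j\<close> of the eigenvalue equation makes
  every block-supported eigenvector a multiple of \<open>\<phi>\<close>, with components
  \<open>v\<close> and \<open>lh - \<alpha>\<close>. A unit one is thus unique up to phase, which
  makes \<open>E_hat\<close> determinate. Its two entries in a column have modulus at most
  1.\<close>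

lemma E_hat_bound: "sum_le (\<lambda>s. cmod (E_hat V q sg j t s j)) 2"
proof -
  define \<phi> where "\<phi> s = (if s = j then v else if s = j - q then complex_of_real (lh - \<alpha>) else 0)" for s
  define N where "N = (cmod v)\<^sup>2 + (lh - \<alpha>)\<^sup>2"
  have N: "0 < N" unfolding N_def using vq by (simp add: add_pos_nonneg)
  have Hq: "Hq V q j t = blockm j (j - q) \<alpha> v (cnj v) \<beta> (\<lambda>s. of_real (psq s t))"
    using Hq_blockm[of 0] by simp
  have app: "(\<Sum>\<^sub>\<infinity>r. Hq V q j t s r * \<psi> r) =
      (if s = j then \<alpha> * \<psi> j + v * \<psi> (j - q) else if s = j - q then cnj v * \<psi> j + \<beta> * \<psi> (j - q)
       else of_real (psq s t) * \<psi> s)" for s and \<psi> :: "idx \<Rightarrow> complex"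
    using mprod_blockm_left[OF jq(2), of \<alpha> v "cnj v" \<beta> "\<lambda>s. of_real (psq s t)" "\<lambda>r _. \<psi> r" s s]
    unfolding Hq mprod_def .
  define ev where "ev \<psi> \<longleftrightarrow> (\<forall>s. s \<notin> {j, j - q} \<longrightarrow> \<psi> s = 0) \<and> (\<Sum>s\<in>{j, j - q}. (cmod (\<psi> s))\<^sup>2) = 1 \<and>
      (\<forall>s. (\<Sum>\<^sub>\<infinity>r. Hq V q j t s r * \<psi> r) = complex_of_real lh * \<psi> s)" for \<psi> :: "idx \<Rightarrow> complex"
  have uniq: "(\<lambda>s r. \<psi> s * cnj (\<psi> r)) = (\<lambda>s r. \<phi> s * cnj (\<phi> r) / of_real N)" if e: "ev \<psi>" for \<psi>
  proof -
    define c where "c = \<psi> j / v"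
    have "\<alpha> * \<psi> j + v * \<psi> (j - q) = lh * \<psi> j" using e unfolding ev_def app by (metis)
    then have "v * \<psi> (j - q) = (lh - \<alpha>) * \<psi> j" by (simp add: algebra_simps)
    then have c2: "\<psi> (j - q) = c * of_real (lh - \<alpha>)" using vq by (simp add: c_def field_simps)
    have c1: "\<psi> j = c * v" using vq by (simp add: c_def)
    have "\<psi> s = 0" if "s \<notin> B" for s using e that unfolding ev_def by blast
    then have ps: "\<psi> s = c * \<phi> s" for s using c1 c2 by (cases "s = j"; cases "s = j - q") (simp_all add: \<phi>_def)
    have "(cmod (\<psi> j))\<^sup>2 + (cmod (\<psi> (j - q)))\<^sup>2 = 1" using e jq by (simp add: ev_def)
    then have "(cmod c)\<^sup>2 * N = 1" unfolding c1 c2 N_def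
      by (simp add: norm_mult power_mult_distrib distrib_left flip: of_real_diff)
    then have "(cmod c)\<^sup>2 = 1 / N" using N by (simp add: field_simps)
    then have "complex_of_real ((cmod c)\<^sup>2) = 1 / of_real N" by (simp only: of_real_divide of_real_1)
    then have cc: "c * cnj c = 1 / of_real N" by (simp only: complex_norm_square)
    show ?thesis
    proof (intro ext)
      fix s r
      have "\<psi> s * cnj (\<psi> r) = (c * cnj c) * (\<phi> s * cnj (\<phi> r))" unfolding ps by (simp add: mult_ac)
      then show "\<psi> s * cnj (\<psi> r) = \<phi> s * cnj (\<phi> r) / of_real N" unfolding cc by simp
    qed
  qed
  define \<psi> where "\<psi> s = \<phi> s / of_real (sqrt N)" for s
  have "ev \<psi>"
    unfolding ev_def app
  proof (intro conjI allI impI)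
    show "s \<notin> {j, j - q} \<Longrightarrow> \<psi> s = 0" for s by (simp add: \<psi>_def \<phi>_def)
    show "(\<Sum>s\<in>{j, j - q}. (cmod (\<psi> s))\<^sup>2) = 1"
      using jq N vq by (simp add: \<psi>_def \<phi>_def norm_divide power_divide N_def flip: add_divide_distrib of_real_diff)
    fix s
    \<comment> \<open>Row \<open>j - q\<close> of the eigenvalue equation for \<open>\<phi>\<close>
      is the characteristic equation \<open>lh_root\<close>.\<close>
    have "cnj v * v + \<beta> * of_real (lh - \<alpha>) = lh * of_real (lh - \<alpha>)"
    proof -
      have "cnj v * v = complex_of_real ((lh - \<alpha>) * (lh - \<beta>))"
        unfolding lh_root complex_norm_square by (simp add: mult.commute)
      then show ?thesis by (simp add: algebra_simps)
    qed
    then have "(cnj v * v + \<beta> * of_real (lh - \<alpha>)) / of_real (sqrt N) = lh * of_real (lh - \<alpha>) / of_real (sqrt N)" by simp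
    then have "cnj v * \<psi> j + \<beta> * \<psi> (j - q) = lh * \<psi> (j - q)"
      using jq by (simp add: \<psi>_def \<phi>_def add_divide_distrib)
    moreover have "\<alpha> * \<psi> j + v * \<psi> (j - q) = lh * \<psi> j"
      using jq N by (simp add: \<psi>_def \<phi>_def field_simps)
    moreover have "s \<noteq> j \<Longrightarrow> s \<noteq> j - q \<Longrightarrow> \<psi> s = 0" by (simp add: \<psi>_def \<phi>_def)
    ultimately show "(if s = j then \<alpha> * \<psi> j + v * \<psi> (j - q) else if s = j - q then cnj v * \<psi> j + \<beta> * \<psi> (j - q)
       else of_real (psq s t) * \<psi> s) = complex_of_real lh * \<psi> s"
      by (cases "s = j"; cases "s = j - q") simp_all
  qed
  have E: "E_hat V q sg j t = (\<lambda>s r. \<psi> s * cnj (\<psi> r))"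
    unfolding E_hat_def conj_assoc[symmetric]
  proof (rule the_equality)
    show "\<exists>\<psi>'. (((\<forall>s. s \<notin> B \<longrightarrow> \<psi>' s = 0) \<and> (\<Sum>s\<in>B. (cmod (\<psi>' s))\<^sup>2) = 1) \<and>
        (\<forall>s. (\<Sum>\<^sub>\<infinity>r. Hq V q j t s r * \<psi>' r) = complex_of_real lh * \<psi>' s)) \<and>
        (\<lambda>s r. \<psi> s * cnj (\<psi> r)) = (\<lambda>s r. \<psi>' s * cnj (\<psi>' r))"
      using \<open>ev \<psi>\<close> unfolding ev_def by blast
    fix E assume "\<exists>\<psi>'. (((\<forall>s. s \<notin> B \<longrightarrow> \<psi>' s = 0) \<and> (\<Sum>s\<in>B. (cmod (\<psi>' s))\<^sup>2) = 1) \<and>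
        (\<forall>s. (\<Sum>\<^sub>\<infinity>r. Hq V q j t s r * \<psi>' r) = complex_of_real lh * \<psi>' s)) \<and> E = (\<lambda>s r. \<psi>' s * cnj (\<psi>' r))"
    then obtain \<psi>' where "ev \<psi>'" "E = (\<lambda>s r. \<psi>' s * cnj (\<psi>' r))" unfolding ev_def by blast
    then show "E = (\<lambda>s r. \<psi> s * cnj (\<psi> r))" using uniq \<open>ev \<psi>\<close> by simp
  qed
  have sq: "(cmod (\<psi> j))\<^sup>2 + (cmod (\<psi> (j - q)))\<^sup>2 = 1" using \<open>ev \<psi>\<close> jq by (simp add: ev_def)
  have supp: "\<psi> s = 0" if "s \<notin> B" for s using \<open>ev \<psi>\<close> that unfolding ev_def by blast
  have le1: "cmod (\<psi> s) \<le> 1" for s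
  proof (cases "s \<in> B")
    case True
    have "(cmod (\<psi> j))\<^sup>2 \<le> 1" "(cmod (\<psi> (j - q)))\<^sup>2 \<le> 1"
      using sq by (smt (verit) zero_le_power2)+
    with True have "(cmod (\<psi> s))\<^sup>2 \<le> 1" by blast
    then show ?thesis using power2_le_imp_le[of "cmod (\<psi> s)" 1] by simp
  next
    case False
    then show ?thesis using supp by simp
  qed
  have "sum_le (\<lambda>s. if s \<in> B then 1 else 0) 2" by (rule sum_le_delta) (use jq in auto)
  then show ?thesis
  proof (rule sum_le_mono)
    fix s
    show "cmod (E_hat V q sg j t s j) \<le> (if s \<in> B then 1 else 0)"
      using le1[of s] le1[of j] supp[of s] unfolding E by (simp add: norm_mult mult_le_one)
  qed auto
qed

text \<open>The column of the model projection contributes \<open>2\<close>, the geometric series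
  \<open>2 / (1 - 1 / 2) = 4\<close>.\<close>

lemma E_pert_bound:
  assumes "good (fourier W)" shows "sum_le (\<lambda>s. cmod (E_pert V q \<epsilon> sg j t W s j)) 6"
proof (rule sum_le_mono[OF sum_le_add[OF E_hat_bound sum_le_series(2)[OF G_bound[OF assms]]]])
qed (auto simp: E_pert_def norm_triangle_ineq)

lemma E_pert_diff:
  assumes w: "good (fourier W)" "good (fourier W')" and \<delta>: "sum_le (\<lambda>m. cmod (fourier W m - fourier W' m)) \<delta>"
  shows "sum_le (\<lambda>s. cmod (E_pert V q \<epsilon> sg j t W s j - E_pert V q \<epsilon> sg j t W' s j)) (832 / \<epsilon> ^ 10 * \<delta>)"
proof -
  note su = sum_le_series(1)[OF G_bound[OF w(1)]] sum_le_series(1)[OF G_bound[OF w(2)]]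
  have "E_pert V q \<epsilon> sg j t W s j - E_pert V q \<epsilon> sg j t W' s j =
      (\<Sum>n. G_hat V q \<epsilon> sg j t W (Suc n) s j - G_hat V q \<epsilon> sg j t W' (Suc n) s j)" for s
    using suminf_diff[OF su, of s] by (simp add: E_pert_def)
  then show ?thesis using sum_le_series(2)[OF G_diff[OF w \<delta>]] by simp
qed

end

section \<open>Traces and the shift of the eigenvalue\<close>

context resonant_model begin

lemma g_hat_eq:
  "g_hat V q \<epsilon> sg j t W n =
    (- 1) ^ n / (2 * complex_of_real pi * \<i> * of_nat n) * (\<Sum>\<^sub>\<infinity>s. CI (\<lambda>z. mpow (K (fourier W) z) n s s))"
proof -
  have "CI (\<lambda>z. mat_pow (RY V q j t W z) n s s) = CI (\<lambda>z. mpow (K (fourier W) z) n s s)" for s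
    by (rule CI_cong) (simp add: RY_eq mat_pow_eq_mpow)
  then show ?thesis by (simp add: g_hat_def circ_def CI_def)
qed

lemma K_minus_L: "K w z s r - Lm (Ymat w) z s r = (if s \<in> B then K w z s r else 0)"
proof (cases "s \<in> B")
  case False
  then have "s \<noteq> j" "s \<noteq> j - q" by auto
  then show ?thesis unfolding K_def Rm_def Let_def mprod_blockm_left[OF jq(2)] Lm_def by simp
qed (simp add: Lm_def)

text \<open>\<open>K\<close> and \<open>Lm\<close> agree outside the block, so the product consists
  of the two block rows of the next power of \<open>K\<close>. Being confined to two rows of weight
  1, it satisfies the trace-type bound with factor \<open>2\<close>.\<close>

lemma nfam_block_rows:
  assumes "good w"
  shows "sph.nfam (\<lambda>z. mprod (\<lambda>s r. K w z s r - Lm (Ymat w) z s r) (mpow (K w z) n)) (2 * \<kappa> ^ Suc n)"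
proof -
  note K = sph.fam_pow[OF K_fam[OF assms], of "Suc n"]
  obtain m where m: "\<forall>z\<in>sphere (complex_of_real lh) d. \<forall>s r. cmod (mpow (K w z) (Suc n) s r) \<le> m s r"
    and col: "colb om m (\<kappa> ^ Suc n)"
    using K unfolding sph.fam_def by blast
  have eq: "mprod (\<lambda>s r. K w z s r - Lm (Ymat w) z s r) (mpow (K w z) n) s r =
      (if s \<in> B then mpow (K w z) (Suc n) s r else 0)" for z s r
    by (cases "s \<in> B") (simp_all add: mprod_def K_minus_L del: insert_iff)
  show ?thesis
  proof (rule sph.nfamI[where d = "\<lambda>s. if s \<in> B then \<kappa> ^ Suc n else 0"])
    show "continuous_on (sphere (complex_of_real lh) d)
        (\<lambda>z. mprod (\<lambda>s r. K w z s r - Lm (Ymat w) z s r) (mpow (K w z) n) s r)" for s r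
      unfolding eq using sph.fam_Q[OF K, of s r] by (cases "s \<in> B") (simp_all del: insert_iff)
    show "cmod (mprod (\<lambda>s r. K w z s r - Lm (Ymat w) z s r) (mpow (K w z) n) s r)
        \<le> (if s \<in> B then \<kappa> ^ Suc n else 0) * om r" if z: "z \<in> sphere (complex_of_real lh) d" for z s r
    proof (cases "s \<in> B")
      case True
      have "cmod (mpow (K w z) (Suc n) s r) \<le> m s r" using m z by blast
      also have "\<dots> \<le> \<kappa> ^ Suc n * om r / om s" by (rule colb_point(2)[OF col om_ge])
      finally show ?thesis unfolding eq om_B[OF True] if_P[OF True] by simp
    next
      case False
      then show ?thesis unfolding eq by simp
    qed
    have "(\<lambda>s. om s * (if s \<in> B then \<kappa> ^ Suc n else 0)) = (\<lambda>s. if s \<in> B then \<kappa> ^ Suc n else 0)"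
      by (rule ext) (simp add: om_def)
    moreover have "sum_le (\<lambda>s. if s \<in> B then \<kappa> ^ Suc n else 0) (2 * \<kappa> ^ Suc n)"
      by (rule sum_le_delta) (use jq \<kappa>_bounds in auto)
    ultimately show "sum_le (\<lambda>s. om s * (if s \<in> B then \<kappa> ^ Suc n else 0)) (2 * \<kappa> ^ Suc n)" by simp
  qed
qed

lemma CI_L:
  assumes "good w" shows "CI (\<lambda>z. mpow (Lm (Ymat w) z) n s r) = 0"
proof -
  let ?f = "\<lambda>z. mpow (Lm (Ymat w) z) n s r"
  have f: "continuous_on (cball (complex_of_real lh) d) ?f" "?f holomorphic_on ball (complex_of_real lh) d"
    using dsc.fam_Q[OF dsc.fam_pow[OF L_fam(2)[OF assms]]] by auto
  have "(?f has_contour_integral 0) (circlepath (complex_of_real lh) d)"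
  proof (rule Cauchy_theorem_convex[OF f(1) convex_cball finite.emptyI])
    show "?f field_differentiable at x" if "x \<in> interior (cball (complex_of_real lh) d) - {}" for x
      using that f(2) by (intro holomorphic_on_imp_differentiable_at) auto
    show "path_image (circlepath (complex_of_real lh) d) \<subseteq> cball (complex_of_real lh) d"
      unfolding path_image_circ by auto
  qed auto
  then show ?thesis unfolding CI_def by (rule contour_integral_unique)
qed

text \<open>By Cauchy's theorem (\<open>CI_L\<close>), subtracting the power of the off-block matrix
  changes no contour integral, and the difference has summable diagonal.\<close>

lemma trace_bound:
  assumes "good w"
  shows "sum_le (\<lambda>s. cmod (CI (\<lambda>z. mpow (K w z) n s s))) (2 * pi * d * (real n * 2 * \<kappa> ^ n))"
proof -
  note K = K_fam[OF assms] and L = L_fam(1)[OF assms]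
  have "CI (\<lambda>z. mpow (K w z) n s s) = CI (\<lambda>z. mpow (K w z) n s s - mpow (Lm (Ymat w) z) n s s)" for s
    using CI_diff[OF sph.fam_Q[OF sph.fam_pow[OF K]] sph.fam_Q[OF sph.fam_pow[OF L]]] CI_L[OF assms] by simp
  then show ?thesis
    using CI_nfam[OF sph.nfam_pow_diff[OF K L nfam_block_rows[OF assms], of n]] by simp
qed

text \<open>The factor \<open>n\<close> of the power difference cancels the \<open>1 / n\<close> in
  \<open>g_hat\<close>. What remains is twice the radius, \<open>2 / 3 * \<epsilon>^10\<close>,
  times a power of \<open>\<kappa>\<close>.\<close>

lemma g_bound:
  assumes "good (fourier W)"
  shows "cmod (g_hat V q \<epsilon> sg j t W (Suc n)) \<le> 2 / 3 * \<epsilon> ^ 10 * \<kappa> * (1 / 2) ^ n"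
proof -
  let ?S = "\<Sum>\<^sub>\<infinity>s. CI (\<lambda>z. mpow (K (fourier W) z) (Suc n) s s)"
  note tb = trace_bound[OF assms, of "Suc n"]
  have "cmod ?S \<le> 2 * pi * d * (real (Suc n) * 2 * \<kappa> ^ Suc n)"
    using sum_le_abs_summable(2)[OF tb order_refl] sum_le_infsum[OF tb] by linarith
  from divide_right_mono[OF this, of "2 * pi * real (Suc n)"]
  have "cmod ?S / (2 * pi * real (Suc n)) \<le> 2 * pi * d * (real (Suc n) * 2 * \<kappa> ^ Suc n) / (2 * pi * real (Suc n))"
    by simp
  moreover have "cmod (g_hat V q \<epsilon> sg j t W (Suc n)) = cmod ?S / (2 * pi * real (Suc n))"
    unfolding g_hat_eq by (simp add: norm_mult norm_divide norm_power del: of_nat_Suc)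
  ultimately have "cmod (g_hat V q \<epsilon> sg j t W (Suc n)) \<le> 2 * pi * d * (real (Suc n) * 2 * \<kappa> ^ Suc n) / (2 * pi * real (Suc n))"
    by (simp only:)
  also have "\<dots> = 2 / 3 * \<epsilon> ^ 10 * \<kappa> * \<kappa> ^ n"
    by (simp add: circ_radius_def del: of_nat_Suc)
  also have "\<dots> \<le> 2 / 3 * \<epsilon> ^ 10 * \<kappa> * (1 / 2) ^ n"
    using eps by (intro mult_left_mono kappa_pow_half) auto
  finally show ?thesis .
qed

lemma lam_pert_close:
  assumes "good (fourier W)" shows "cmod (lam_pert V q \<epsilon> sg j t W - of_real lh) \<le> 3400 * \<epsilon> ^ 11"
proof -
  let ?g = "\<lambda>n. g_hat V q \<epsilon> sg j t W (Suc n)" and ?C = "2 / 3 * \<epsilon> ^ 10 * \<kappa>"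
  have C: "summable (\<lambda>n. ?C * (1 / 2) ^ n)" by (intro summable_mult summable_geometric) simp
  have s: "summable (\<lambda>n. cmod (?g n))"
    by (rule summable_comparison_test'[OF C]) (use g_bound[OF assms] in simp)
  have "cmod (\<Sum>n. ?g n) \<le> (\<Sum>n. cmod (?g n))" by (rule summable_norm[OF s])
  also have "\<dots> \<le> (\<Sum>n. ?C * (1 / 2) ^ n)" by (rule suminf_le[OF g_bound[OF assms] s C])
  also have "\<dots> = ?C * 2"
    using suminf_mult[OF summable_geometric[of "1 / 2 :: real"], of ?C] by (simp add: suminf_geometric)
  \<comment> \<open>The constant is \<open>2 / 3 * 2500 * 2\<close>, which is below
    \<open>3400\<close>.\<close>
  also have "\<dots> \<le> 3400 * \<epsilon> ^ 11"
  proof -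
    have "\<epsilon> ^ 11 = \<epsilon> ^ 10 * \<epsilon>" by (simp flip: power_Suc2)
    then show ?thesis using eps by simp
  qed
  finally show ?thesis by (simp add: lam_pert_def)
qed

end

subsection \<open>Nonlinear iteration\<close>

lemma trig_add_cmult:
  assumes "sum_le (\<lambda>m. cmod (a m)) c" "sum_le (\<lambda>m. cmod (b m)) c'"
  shows "trig (\<lambda>m. a m + k * b m) x = trig a x + k * trig b x"
proof -
  have "(\<lambda>m. k * (b m * wave (rvec m) x)) summable_on UNIV"
    by (intro summable_on_cmult_right trig_summable[OF assms(2)])
  from infsum_add[OF trig_summable[OF assms(1)] this] show ?thesis
    by (simp add: trig_def distrib_right infsum_cmult_right' mult.assoc)
qed

lemma sum_le_star_diff:
  assumes "f \<in> star_space" "g \<in> star_space"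
  shows "sum_le (\<lambda>m. cmod (fourier f m - fourier g m)) (star_norm (\<lambda>x. f x - g x))"
proof -
  have "sum_le (\<lambda>m. cmod (fourier f m - fourier g m)) (star_norm f + star_norm g)"
    by (rule sum_le_mono[OF sum_le_add[OF star_space_sum_le[OF assms(1)] star_space_sum_le[OF assms(2)]]])
      (auto simp: norm_triangle_ineq4)
  from sum_le_of_summable[OF sum_le_summable[OF this] _ order_refl]
  show ?thesis unfolding star_norm_def fourier_diff_star[OF assms] by simp
qed

lemma star_norm_nonneg: "0 \<le> star_norm f"
  unfolding star_norm_def by (rule infsum_nonneg) simp

locale nonlinear_model = resonant_model +
  fixes \<sigma> :: real and A :: complex
  assumes small: "\<bar>\<sigma>\<bar> * (cmod A)\<^sup>2 < \<epsilon> ^ 11"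
begin

abbreviation "MM \<equiv> M_hat V q \<sigma> A \<epsilon> sg j t"

definition col :: "(plane \<Rightarrow> complex) \<Rightarrow> idx \<Rightarrow> complex" where
  "col W s = E_pert V q \<epsilon> sg j t W s j"

text \<open>The Fourier coefficients of \<open>MM W\<close>: the quasiperiodic factor
  \<open>wave t\<close> of \<open>u_fun\<close> has modulus 1 and drops out of the squared modulus,
  leaving a periodic function.\<close>

definition coef :: "(plane \<Rightarrow> complex) \<Rightarrow> idx \<Rightarrow> complex" where
  "coef W m = fourier V m + of_real (\<sigma> * (cmod A)\<^sup>2) * corr (col W) (col W) m"

lemma col_bound: "good (fourier W) \<Longrightarrow> sum_le (\<lambda>s. cmod (col W s)) 6"
  unfolding col_def by (rule E_pert_bound)

lemma u_fun_eq: "u_fun V q A \<epsilon> sg j t W x = A * wave t x * trig (col W) x"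
  unfolding u_fun_def trig_def col_def P_def wave_add
  by (simp add: infsum_cmult_right' infsum_cmult_left' flip: mult.assoc)

lemma norm_coupling: "cmod (of_real (\<sigma> * (cmod A)\<^sup>2)) \<le> \<epsilon> ^ 11"
  using small unfolding norm_of_real by (simp add: abs_mult)

lemma M_hat_trig:
  assumes "good (fourier W)" shows "MM W = trig (coef W)"
proof
  fix x
  note c = col_bound[OF assms]
  have "complex_of_real (\<sigma> * (cmod (u_fun V q A \<epsilon> sg j t W x))\<^sup>2) =
      of_real (\<sigma> * (cmod A)\<^sup>2) * (trig (col W) x * cnj (trig (col W) x))"
    unfolding u_fun_eq complex_norm_square[symmetric] by (simp add: norm_mult power_mult_distrib)
  then show "MM W x = trig (coef W) x"
    unfolding M_hat_def coef_def[abs_def] trig_add_cmult[OF V_sum_le sum_le_corr[OF c c]] trig_corr[OF c c]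
    using trig_potential_trig[OF pot] by (metis)
qed

lemma coef_minus_V:
  assumes "good (fourier W)" shows "good (coef W)"
  unfolding good_def
proof (rule sum_le_mono)
  note c = col_bound[OF assms]
  show "sum_le (\<lambda>m. \<epsilon> ^ 11 * cmod (corr (col W) (col W) m)) (\<epsilon> ^ 11 * (6 * 6))"
    by (rule sum_le_cmult[OF sum_le_corr[OF c c]]) (use eps in simp)
  show "cmod (coef W m - fourier V m) \<le> \<epsilon> ^ 11 * cmod (corr (col W) (col W) m)" for m
    unfolding coef_def add_diff_cancel_left' norm_mult by (rule mult_right_mono[OF norm_coupling]) simp
qed (use eps in auto)

text \<open>The factors \<open>\<epsilon>^11\<close> from the coupling and
  \<open>1 / \<epsilon>^10\<close> from \<open>E_pert_diff\<close> leave one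
  \<open>\<epsilon>\<close>; the contraction constant is \<open>2 * 6 * 832 * \<epsilon>\<close>,
  less than \<open>1 / 2\<close>.\<close>

lemma coef_diff:
  assumes w: "good (fourier W)" "good (fourier W')" and \<delta>: "sum_le (\<lambda>m. cmod (fourier W m - fourier W' m)) \<delta>"
  shows "sum_le (\<lambda>m. cmod (coef W m - coef W' m)) (1 / 2 * \<delta>)"
proof (rule sum_le_mono)
  note c = col_bound[OF w(1)] col_bound[OF w(2)]
  have "sum_le (\<lambda>s. cmod (col W s - col W' s)) (832 / \<epsilon> ^ 10 * \<delta>)"
    unfolding col_def by (rule E_pert_diff[OF w \<delta>])
  from sum_le_corr_diff[OF c this]
  show "sum_le (\<lambda>m. \<epsilon> ^ 11 * cmod (corr (col W) (col W) m - corr (col W') (col W') m))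
      (\<epsilon> ^ 11 * (2 * 6 * (832 / \<epsilon> ^ 10 * \<delta>)))"
    by (rule sum_le_cmult) (use eps in simp)
  show "cmod (coef W m - coef W' m) \<le> \<epsilon> ^ 11 * cmod (corr (col W) (col W) m - corr (col W') (col W') m)" for m
    unfolding coef_def add_diff_cancel_left right_diff_distrib[symmetric] norm_mult
    by (rule mult_right_mono[OF norm_coupling]) simp
  have "\<epsilon> ^ 11 = \<epsilon> * \<epsilon> ^ 10" by (simp flip: power_Suc)
  then have "\<epsilon> ^ 11 * (2 * 6 * (832 / \<epsilon> ^ 10 * \<delta>)) = (9984 * \<epsilon>) * \<delta>" using eps by simp
  also have "\<dots> \<le> 1 / 2 * \<delta>" using eps sum_le_bound_nonneg[OF \<delta>] by (intro mult_right_mono) auto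
  finally show "\<epsilon> ^ 11 * (2 * 6 * (832 / \<epsilon> ^ 10 * \<delta>)) \<le> 1 / 2 * \<delta>" .
qed simp

lemma M_hat_facts:
  assumes "good (fourier W)"
  shows "MM W \<in> star_space" "fourier (MM W) = coef W" "good (fourier (MM W))"
proof -
  note s = good_sum_le[OF coef_minus_V[OF assms]]
  show "MM W \<in> star_space" unfolding M_hat_trig[OF assms] by (rule trig_star_space(1)[OF s])
  show f: "fourier (MM W) = coef W" unfolding M_hat_trig[OF assms] using fourier_trig[OF s] by (rule ext)
  show "good (fourier (MM W))" unfolding f by (rule coef_minus_V[OF assms])
qed

abbreviation "Wn n \<equiv> (MM ^^ n) V"

lemma Wn_good: "good (fourier (Wn n))"
  by (induction n) (auto simp: good_V M_hat_facts(3))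

lemma Wn_star: "Wn n \<in> star_space"
  by (cases n) (auto simp: trig_potential_star[OF pot] intro: M_hat_facts(1)[OF Wn_good])

lemma Wn_step: "sum_le (\<lambda>m. cmod (fourier (Wn (Suc n)) m - fourier (Wn n) m)) (100 * \<epsilon> ^ 11 * (1 / 2) ^ n)"
proof (induction n)
  case 0
  then show ?case using Wn_good[of 1] by (simp add: good_def)
next
  case (Suc n)
  from coef_diff[OF Wn_good Wn_good Suc.IH]
  have "sum_le (\<lambda>m. cmod (fourier (MM (Wn (Suc n))) m - fourier (MM (Wn n)) m)) (1 / 2 * (100 * \<epsilon> ^ 11 * (1 / 2) ^ n))"
    unfolding M_hat_facts(2)[OF Wn_good] .
  then show ?case by (simp add: mult_ac)
qed

text \<open>The limit is built coefficientwise as a telescoping series. Its tails are geometric in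
  l1, so the resulting function lies in \<open>star_space\<close> and is the limit in the star
  norm.\<close>

lemma Wn_converges: "\<exists>W. star_limit Wn W"
proof -
  define g where "g n m = fourier (Wn (Suc n)) m - fourier (Wn n) m" for n m
  define w where "w m = fourier V m + (\<Sum>n. g n m)" for m
  let ?C = "100 * \<epsilon> ^ 11"
  have g: "sum_le (\<lambda>m. cmod (g (n + N) m)) (?C * (1 / 2) ^ N * (1 / 2) ^ n)" for n N
    using Wn_step[of "n + N"] by (simp add: g_def power_add mult_ac)
  have sg: "summable (\<lambda>n. g n m)" for m
    using sum_le_series(1)[OF g[where N = 0]] by simp
  have diff: "w m - fourier (Wn N) m = (\<Sum>n. g (n + N) m)" for N m
  proof -
    have "(\<Sum>n<N. g n m) = fourier (Wn N) m - fourier V m"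
      unfolding g_def by (subst sum_lessThan_telescope) simp
    then show ?thesis using suminf_split_initial_segment[OF sg, of m N] by (simp add: w_def)
  qed
  have close: "sum_le (\<lambda>m. cmod (w m - fourier (Wn N) m)) (2 * ?C * (1 / 2) ^ N)" for N
    unfolding diff using sum_le_series(2)[OF g[where N = N]] by (simp add: mult.assoc)
  have w: "sum_le (\<lambda>m. cmod (w m)) (2 * ?C + \<epsilon> ^ 9)"
  proof (rule sum_le_mono[OF sum_le_add[OF close[of 0] V_sum_le]])
    show "cmod (w m) \<le> cmod (w m - fourier (Wn 0) m) + cmod (fourier V m)" for m
      using norm_triangle_ineq[of "w m - fourier V m" "fourier V m"] by simp
  qed auto
  have W: "trig w \<in> star_space" "fourier (trig w) = w"
    using trig_star_space(1)[OF w] fourier_trig[OF w] by auto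
  have "star_norm (\<lambda>x. Wn n x - trig w x) \<le> 2 * ?C * (1 / 2) ^ n" for n
    using close[of n] by (intro star_norm_le) (simp add: fourier_diff_star[OF Wn_star W(1)] W(2) norm_minus_commute)
  moreover have "(\<lambda>n. 2 * ?C * (1 / 2) ^ n) \<longlonglongrightarrow> 0"
    by (intro tendsto_mult_right_zero LIMSEQ_power_zero) simp
  ultimately have "(\<lambda>n. star_norm (\<lambda>x. Wn n x - trig w x)) \<longlonglongrightarrow> 0"
    by - (rule Lim_null_comparison[where g = "\<lambda>n. 2 * ?C * (1 / 2) ^ n"],
      simp_all only: real_norm_def abs_of_nonneg[OF star_norm_nonneg] eventually_True)
  then have "star_limit Wn (trig w)" using Wn_star W(1) by (simp add: star_limit_def)
  then show ?thesis by blast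
qed

text \<open>The bound holds for all iterates and passes to whichever star-norm limit is chosen, by
  testing it on finite sets of coefficients.\<close>

lemma W_limit_good: "good (fourier (W_limit V q \<sigma> A \<epsilon> sg j t))"
proof -
  let ?W = "W_limit V q \<sigma> A \<epsilon> sg j t"
  have lim: "star_limit Wn ?W" unfolding W_limit_def by (rule someI_ex[OF Wn_converges])
  then have W: "?W \<in> star_space" and tends: "(\<lambda>n. star_norm (\<lambda>x. Wn n x - ?W x)) \<longlonglongrightarrow> 0"
    by (auto simp: star_limit_def)
  show ?thesis unfolding good_def
  proof (rule sum_leI)
    fix S :: "idx set" assume S: "finite S"
    have "(\<Sum>m\<in>S. cmod (fourier ?W m - fourier V m)) \<le> star_norm (\<lambda>x. Wn n x - ?W x) + 100 * \<epsilon> ^ 11" for n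
    proof -
      have "(\<Sum>m\<in>S. cmod (fourier ?W m - fourier V m)) \<le>
          (\<Sum>m\<in>S. cmod (fourier (Wn n) m - fourier ?W m) + cmod (fourier (Wn n) m - fourier V m))"
      proof (rule sum_mono)
        fix m
        show "cmod (fourier ?W m - fourier V m) \<le> cmod (fourier (Wn n) m - fourier ?W m) + cmod (fourier (Wn n) m - fourier V m)"
          using norm_triangle_ineq4[of "fourier (Wn n) m - fourier V m" "fourier (Wn n) m - fourier ?W m"] by simp
      qed
      also have "\<dots> \<le> star_norm (\<lambda>x. Wn n x - ?W x) + 100 * \<epsilon> ^ 11"
        unfolding sum.distrib
        by (intro add_mono sum_le_finite[OF sum_le_star_diff[OF Wn_star W] S]
            sum_le_finite[OF Wn_good[unfolded good_def] S])
      finally show ?thesis .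
    qed
    moreover have "(\<lambda>n. star_norm (\<lambda>x. Wn n x - ?W x) + 100 * \<epsilon> ^ 11) \<longlonglongrightarrow> 0 + 100 * \<epsilon> ^ 11"
      by (intro tendsto_add tends tendsto_const)
    ultimately show "(\<Sum>m\<in>S. cmod (fourier ?W m - fourier V m)) \<le> 100 * \<epsilon> ^ 11"
      using LIMSEQ_le_const[of _ "0 + 100 * \<epsilon> ^ 11"] by auto
  qed simp
qed

end

subsection \<open>Level curves of the model eigenvalue\<close>

text \<open>Along the ray through \<open>P j t\<close> the square of the radius grows at rate about
  \<open>2 * p\<close>, while all other terms of the model eigenvalue are Lipschitz with constant
  \<open>2 * R\<close> in total. The distance \<open>\<eta> / k\<close> is thus enough to pass the
  level in both directions.\<close>

lemma lam_hat_level_near: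
  assumes q: "norm (rvec q) \<le> R" and sg: "sg \<in> {1, - 1}"
    and p: "k \<le> norm (P j t) + 1" and k: "3 + 2 * R \<le> k"
    and \<eta>: "0 \<le> \<eta>" "\<eta> \<le> k" and close: "\<bar>lam_hat V q sg j t - lam0\<bar> \<le> \<eta>"
  shows "\<exists>s. lam_hat V q sg j s = lam0 \<and> dist s t \<le> \<eta> / k"
proof -
  define p where "p = norm (P j t)"
  define e where "e = (1 / p) *\<^sub>R P j t"
  define c where "c = e \<bullet> rvec q"
  define x where "x = 2 * cmod (fourier V q)"
  define D where "D \<tau> = 2 * (p + \<tau>) * c - (norm (rvec q))\<^sup>2" for \<tau>
  define f where "f \<tau> = lam_hat V q sg j (t + \<tau> *\<^sub>R e)" for \<tau>
  have R0: "0 \<le> R" using q norm_ge_zero order_trans by blast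
  have k0: "0 < k" and p0: "0 < p" using k R0 p by (auto simp: p_def)
  have e1: "norm e = 1" using p0 by (simp add: e_def p_def)
  have "P j t = p *\<^sub>R e" using p0 by (simp add: e_def)
  then have Pj: "P j (t + \<tau> *\<^sub>R e) = (p + \<tau>) *\<^sub>R e" for \<tau>
    by (simp add: P_def scaleR_add_left flip: add.assoc)
  have Pq: "P (j - q) (t + \<tau> *\<^sub>R e) = (p + \<tau>) *\<^sub>R e - rvec q" for \<tau>
    using Pj[of \<tau>] by (simp add: P_def algebra_simps)
  have psqj: "psq j (t + \<tau> *\<^sub>R e) = (p + \<tau>)\<^sup>2" for \<tau>
    unfolding psq_def Pj by (simp add: e1 power_mult_distrib)
  have psqq: "psq (j - q) (t + \<tau> *\<^sub>R e) = (p + \<tau>)\<^sup>2 - D \<tau>" for \<tau>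
  proof -
    have "psq (j - q) (t + \<tau> *\<^sub>R e) = (p + \<tau>)\<^sup>2 * (norm e)\<^sup>2 - 2 * ((p + \<tau>) * c) + (norm (rvec q))\<^sup>2"
      unfolding psq_def Pq power2_norm_eq_inner c_def
      by (simp add: inner_diff_left inner_diff_right inner_commute power2_eq_square algebra_simps)
    then show ?thesis by (simp add: e1 D_def)
  qed
  \<comment> \<open>Reading the square root as the norm of the pair \<open>(x, D \<tau>)\<close>
    gives its Lipschitz bound from the triangle inequality, without differentiation.\<close>
  have f: "f \<tau> = (p + \<tau>)\<^sup>2 - D \<tau> / 2 + sg * (norm (x, D \<tau>) / 2)" for \<tau>
    unfolding f_def lam_hat_def psqj psqq by (simp add: norm_Pair x_def power_mult_distrib field_simps)
  have cq: "\<bar>c\<bar> \<le> R"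
    using Cauchy_Schwarz_ineq2[of e "rvec q"] q by (simp add: c_def e1)
  have lip: "\<bar>norm (x, D \<tau>) - norm (x, D 0)\<bar> \<le> 2 * \<bar>\<tau>\<bar> * R" for \<tau>
  proof -
    have "\<bar>norm (x, D \<tau>) - norm (x, D 0)\<bar> \<le> norm ((x, D \<tau>) - (x, D 0))" by (rule norm_triangle_ineq3)
    also have "(x, D \<tau>) - (x, D 0) = (0, 2 * \<tau> * c)" by (simp add: D_def algebra_simps)
    also have "norm \<dots> = 2 * \<bar>\<tau>\<bar> * \<bar>c\<bar>" by (simp add: norm_Pair abs_mult)
    also have "\<dots> \<le> 2 * \<bar>\<tau>\<bar> * R" using cq by (intro mult_left_mono) auto
    finally show ?thesis .
  qed
  have dev: "\<bar>f \<tau> - f 0 - (2 * p * \<tau> + \<tau>\<^sup>2)\<bar> \<le> 2 * \<bar>\<tau>\<bar> * R" for \<tau>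
  proof -
    have "f \<tau> - f 0 - (2 * p * \<tau> + \<tau>\<^sup>2) = - \<tau> * c + sg * ((norm (x, D \<tau>) - norm (x, D 0)) / 2)"
      unfolding f by (simp add: D_def power2_eq_square field_simps)
    also have "\<bar>\<dots>\<bar> \<le> \<bar>\<tau>\<bar> * \<bar>c\<bar> + \<bar>norm (x, D \<tau>) - norm (x, D 0)\<bar> / 2"
      using sg by (intro order_trans[OF abs_triangle_ineq]) (auto simp: abs_mult)
    also have "\<dots> \<le> \<bar>\<tau>\<bar> * R + (2 * \<bar>\<tau>\<bar> * R) / 2"
      using cq lip[of \<tau>] by (intro add_mono mult_left_mono) auto
    finally show ?thesis by (simp add: mult_ac)
  qed
  define \<tau>0 where "\<tau>0 = \<eta> / k"
  have \<tau>0: "0 \<le> \<tau>0" "\<tau>0 \<le> 1" "k * \<tau>0 = \<eta>" using \<eta> k0 by (auto simp: \<tau>0_def)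
  \<comment> \<open>From \<open>p \<ge> k - 1\<close> and \<open>k \<ge> 3 + 2 * R\<close>. The
    surplus \<open>2 * R + 1\<close> over \<open>k\<close> pays for the Lipschitz terms and for the
    quadratic term, which is at most \<open>\<tau>0\<close> since
    \<open>\<tau>0 \<le> 1\<close>.\<close>
  have rate: "k + 2 * R + 1 \<le> 2 * p" using p k by (simp add: p_def)
  have slope: "\<eta> + 2 * \<tau>0 * R + \<tau>0\<^sup>2 \<le> 2 * p * \<tau>0"
  proof -
    have "\<tau>0\<^sup>2 \<le> \<tau>0" using \<tau>0 by (simp add: power2_eq_square mult_left_le)
    moreover have "(k + 2 * R + 1) * \<tau>0 \<le> 2 * p * \<tau>0" by (rule mult_right_mono[OF rate \<tau>0(1)])
    ultimately show ?thesis using \<tau>0(3) by (simp add: algebra_simps)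
  qed
  have f0: "f 0 = lam_hat V q sg j t" by (simp add: f_def)
  have up: "lam0 \<le> f \<tau>0"
    using dev[of \<tau>0] slope \<tau>0(1) close zero_le_power2[of \<tau>0] unfolding f0 abs_le_iff abs_of_nonneg[OF \<tau>0(1)] by linarith
  have low: "f (- \<tau>0) \<le> lam0"
    using dev[of "- \<tau>0"] slope \<tau>0(1) close unfolding f0 abs_le_iff by simp
  have "continuous_on {- \<tau>0..\<tau>0} f"
    unfolding f D_def by (intro continuous_intros) auto
  then obtain \<tau> where \<tau>: "- \<tau>0 \<le> \<tau>" "\<tau> \<le> \<tau>0" "f \<tau> = lam0"
    using IVT'[of f "- \<tau>0" lam0 \<tau>0] low up \<tau>0 by auto
  have "dist (t + \<tau> *\<^sub>R e) t \<le> \<eta> / k" using \<tau> by (simp add: dist_norm e1 flip: \<tau>0_def)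
  with \<tau>(3) show ?thesis unfolding f_def by blast
qed

section \<open>From the eigenvalue estimate to the level curves\<close>

theorem theorem43:
  shows "\<exists>\<epsilon>0>0. \<forall>(R0::real) (V::plane \<Rightarrow> complex). trig_potential R0 V \<longrightarrow>
    (\<exists>k1>0. \<exists>C>0. \<forall>(q::idx) (\<epsilon>::real) (\<sigma>::real) (A::complex) (lam0::real) (k::real) (c::real) (Xq::plane set).
      q \<noteq> 0 \<and> fourier V q \<noteq> 0 \<and>
      0 < \<epsilon> \<and> \<epsilon> < \<epsilon>0 \<and>
      star_norm V < \<epsilon> ^ 9 \<and>
      cmod (fourier V q) > \<epsilon> ^ 10 \<and>
      \<bar>\<sigma>\<bar> * (cmod A)\<^sup>2 < \<epsilon> ^ 11 \<and>
      lam0 > k1\<^sup>2 \<and> k = sqrt lam0 \<and>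
      resonant_set V q k \<epsilon> c Xq \<longrightarrow>
      (\<forall>sg\<in>{1, - 1}. \<forall>j.
         {t \<in> nbhd_piece q k \<epsilon> Xq j. lam V q \<sigma> A \<epsilon> sg j t = complex_of_real lam0}
         \<subseteq> (\<Union>s\<in>{s. lam_hat V q sg j s = lam0}. ball s (C * \<epsilon> ^ 11 * lam0 powr (- 1 / 2)))))"
\<comment> \<open>The main demands on \<open>\<epsilon>\<close> are
  \<open>2500 * \<epsilon> \<le> 1 / 4\<close> for the series and
  \<open>9984 * \<epsilon> \<le> 1 / 2\<close> for the contraction; both hold with room to
  spare.\<close>
proof (rule exI[of _ "1 / 100000"], intro conjI allI impI)
  fix R0 :: real and V :: "plane \<Rightarrow> complex"
  assume pot: "trig_potential R0 V"
  show "\<exists>k1>0. \<exists>C>0. \<forall>(q::idx) (\<epsilon>::real) (\<sigma>::real) (A::complex) (lam0::real) (k::real) (c::real) (Xq::plane set).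
      q \<noteq> 0 \<and> fourier V q \<noteq> 0 \<and>
      0 < \<epsilon> \<and> \<epsilon> < 1 / 100000 \<and>
      star_norm V < \<epsilon> ^ 9 \<and>
      cmod (fourier V q) > \<epsilon> ^ 10 \<and>
      \<bar>\<sigma>\<bar> * (cmod A)\<^sup>2 < \<epsilon> ^ 11 \<and>
      lam0 > k1\<^sup>2 \<and> k = sqrt lam0 \<and>
      resonant_set V q k \<epsilon> c Xq \<longrightarrow>
      (\<forall>sg\<in>{1, - 1}. \<forall>j.
         {t \<in> nbhd_piece q k \<epsilon> Xq j. lam V q \<sigma> A \<epsilon> sg j t = complex_of_real lam0}
         \<subseteq> (\<Union>s\<in>{s. lam_hat V q sg j s = lam0}. ball s (C * \<epsilon> ^ 11 * lam0 powr (- 1 / 2))))"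
  \<comment> \<open>\<open>k1\<close> is the lower bound on \<open>k\<close> in
    \<open>lam_hat_level_near\<close> with \<open>R = |R0|\<close>. The constant \<open>4000\<close>
    exceeds \<open>3400\<close> because the balls are open and the distance estimate is not
    strict.\<close>
  proof (rule exI[of _ "3 + 2 * \<bar>R0\<bar>"], rule conjI[rotated], rule exI[of _ 4000],
      intro conjI allI impI ballI subsetI, goal_cases)
    case (2 q \<epsilon> \<sigma> A lam0 k c Xq sg j t)
    then have hyps: "q \<noteq> 0" "fourier V q \<noteq> 0" "0 < \<epsilon>" "\<epsilon> < 1 / 100000" "star_norm V < \<epsilon> ^ 9"
      "\<bar>\<sigma>\<bar> * (cmod A)\<^sup>2 < \<epsilon> ^ 11" "(3 + 2 * \<bar>R0\<bar>)\<^sup>2 < lam0" "k = sqrt lam0"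
      and res: "resonant_set V q k \<epsilon> c Xq" and sg: "sg \<in> {1, - 1}"
      and t: "t \<in> nbhd_piece q k \<epsilon> Xq j" and lam: "lam V q \<sigma> A \<epsilon> sg j t = complex_of_real lam0"
      by blast+
    interpret nonlinear_model V R0 q j t sg \<epsilon> \<sigma> A
    proof
      fix z m assume z: "z \<in> sphere (complex_of_real (lam_hat V q sg j t)) (circ_radius \<epsilon>)"
      with res sg t have "(\<forall>m. m \<noteq> j \<and> m \<noteq> j - q \<longrightarrow> \<epsilon> ^ 6 \<le> 2 * cmod (complex_of_real (psq m t) - z)) \<and>
          1 / 12 * \<epsilon> ^ 10 \<le> cmod (complex_of_real (lam_hat V q 1 j t) - z) \<and>
          1 / 12 * \<epsilon> ^ 10 \<le> cmod (complex_of_real (lam_hat V q (- 1) j t) - z)"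
        unfolding resonant_set_def by blast
      then show "m \<noteq> j \<Longrightarrow> m \<noteq> j - q \<Longrightarrow> \<epsilon> ^ 6 \<le> 2 * cmod (complex_of_real (psq m t) - z)"
        "1 / 12 * \<epsilon> ^ 10 \<le> cmod (complex_of_real (lam_hat V q 1 j t) - z)"
        "1 / 12 * \<epsilon> ^ 10 \<le> cmod (complex_of_real (lam_hat V q (- 1) j t) - z)"
        by blast+
    qed (use pot hyps sg in auto)
    have k: "3 + 2 * \<bar>R0\<bar> < k" unfolding hyps(8) using hyps(7) by (intro real_less_rsqrt) auto
    have kpos: "0 < k" using k by linarith
    have "norm (complex_of_real lam0 - complex_of_real (lam_hat V q sg j t)) \<le> 3400 * \<epsilon> ^ 11"
      using lam_pert_close[OF W_limit_good] lam unfolding lam_def by simp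
    then have close: "\<bar>lam_hat V q sg j t - lam0\<bar> \<le> 3400 * \<epsilon> ^ 11"
      unfolding of_real_diff[symmetric] norm_of_real by simp
    have eps1: "\<epsilon> ^ 11 \<le> 1 / 100000"
      using power_decreasing[of 1 11 \<epsilon>] hyps(3,4) by simp
    obtain t0 where t0: "norm (P j t0) = k" "dist t t0 < 1 / 8 * (1 / k) * \<epsilon> ^ 10"
      using t unfolding nbhd_piece_def res_index_def Sq_def by auto
    \<comment> \<open>Only the nearby point \<open>t0\<close> of the resonant set has
      \<open>P j t0\<close> exactly on the circle of radius \<open>k\<close>; the passage to
      \<open>t\<close> costs at most \<open>1 / 8\<close>.\<close>
    have "k \<le> norm (P j t) + 1"
    proof -
      have "1 / 8 * (1 / k) * \<epsilon> ^ 10 \<le> 1 / 8 * 1 * 1"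
        using k hyps(3,4) by (intro mult_mono power_le_one) (auto simp: field_simps)
      moreover have "norm (P j t0) \<le> norm (P j t) + dist t t0"
        using norm_triangle_ineq[of "P j t" "t0 - t"] by (simp add: P_def dist_norm norm_minus_commute)
      ultimately show ?thesis using t0 by simp
    qed
    moreover have "norm (rvec q) \<le> \<bar>R0\<bar>"
      using trig_potential_support[OF pot hyps(2)] by simp
    moreover have "0 \<le> 3400 * \<epsilon> ^ 11" "3400 * \<epsilon> ^ 11 \<le> k" using eps1 k hyps(3) by auto
    ultimately obtain s where s: "lam_hat V q sg j s = lam0" "dist s t \<le> 3400 * \<epsilon> ^ 11 / k"
      using lam_hat_level_near[OF _ sg _ less_imp_le[OF k] _ _ close] by blast
    have "lam0 powr (- 1 / 2) = 1 / k"
      using kpos unfolding hyps(8) by (simp add: powr_minus_divide powr_half_sqrt)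
    moreover have "3400 * \<epsilon> ^ 11 / k < 4000 * \<epsilon> ^ 11 / k"
      using hyps(3) kpos by (intro divide_strict_right_mono) auto
    ultimately have "t \<in> ball s (4000 * \<epsilon> ^ 11 * lam0 powr (- 1 / 2))" using s(2) by simp
    moreover have "s \<in> {s. lam_hat V q sg j s = lam0}" using s(1) by simp
    ultimately show ?case by (rule UN_I[rotated])
  qed simp_all
qed simp

end
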